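(* Let $G\le \mathrm{Homeo}^+(\mathbb{R})$ be an $n$-chain group. Then exactly one of the following holds: (i) The action of $G$ is minimal; in this case every proper quotient of $G$ is abelian and the commutator subgroup $G'\le G$ is simple. (ii) The closure of some $G$-orbit is perfect and totally disconnected; in this case $G$ canonically surjects onto an $n$-chain group that acts minimally.
   Context: $\mathrm{Homeo}^+(\mathbb{R})$ is the group of orientation preserving homeomorphisms of $\mathbb{R}$. For $f\in\mathrm{Homeo}^+(\mathbb{R})$, $\operatorname{supp} f=\{x: f(x)\ne x\}$, and $\operatorname{supp} G=\bigcup_{g\in G}\operatorname{supp} g$. For an interval $J$, $\partial^-J$ is its left endpoint. Chain of intervals: a collection $\{J_1,\ldots,J_n\}$ of nonempty open subintervals of $\mathbb{R}$ (possibly unbounded) such that $J_i\cap J_k=\varnothing$ if $|i-k|>1$, and $J_i\cap J_{i+1}$ is a proper nonempty subinterval of both $J_i$ and $J_{i+1}$ for $1\le i\le n-1$. $n$-chain group ($n\ge 2$): a group $\langle f_1,\ldots,f_n\rangle\le\mathrm{Homeo}^+(\mathbb{R})$ where $\{\operatorname{supp} f_1,\dots,\operatorname{supp} f_n\}$ is a chain of intervals with $\partial^-\operatorname{supp} f_i<\partial^-\operatorname{supp} f_{i+1}$ for all $i<n$, $f_i(t)\ge t$ for all $t$ and $i$, and $\langle f_i,f_{i+1}\rangle\cong F$ for each $1\le i\le n-1$. Here $F=\langle \{g_i\}_{i\ge0}\mid g_i^{-1}g_jg_i=g_{j+1}\text{ for }0\le i<j\rangle$ is Thompson's group. The action of $G$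 is minimal if the $G$-orbit of every point of $\operatorname{supp} G$ is dense in $\operatorname{supp} G$. In (ii), orbits of points of the open interval $\operatorname{supp} G$ are meant, with closure taken in $\operatorname{supp} G$. "Canonically" in (ii) refers to the minimalization: identifying the open interval $\operatorname{supp} G$ with $\mathbb{R}$ and letting $\Lambda$ be the perfect, totally disconnected orbit closure, there are a monotone continuous surjection $h\colon\mathbb{R}\to\mathbb{R}$, mapping the closure of each component of $\mathbb{R}\setminus\Lambda$ to a single point, and a homomorphism $\Phi\colon G\to\mathrm{Homeo}^+(\mathbb{R})$ with $h\circ g=\Phi(g)\circ h$ for all $g\in G$; the surjection is $G\to\Phi(G)$. *)

theory Defs
  imports "HOL-Analysis.Analysis" "HOL-Algebra.Generated_Groups"
begin

text \<open>
  Words are lists of letters; the letter \<open>(a, True)\<close> stands for the generator \<open>a\<close> and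
  \<open>(a, False)\<close> for its formal inverse. A pair \<open>(u, v)\<close> in \<open>R\<close> is the relation \<open>u = v\<close>.
\<close>

inductive word_eq :: "(('a \<times> bool) list \<times> ('a \<times> bool) list) set
    \<Rightarrow> ('a \<times> bool) list \<Rightarrow> ('a \<times> bool) list \<Rightarrow> bool"
  for R where
  refl: "word_eq R w w"
| sym: "word_eq R u v \<Longrightarrow> word_eq R v u"
| trans: "word_eq R u v \<Longrightarrow> word_eq R v w \<Longrightarrow> word_eq R u w"
| append: "word_eq R u u' \<Longrightarrow> word_eq R v v' \<Longrightarrow> word_eq R (u @ v) (u' @ v')"
| cancel: "word_eq R [(a, b), (a, \<not> b)] []"
| relation: "(u, v) \<in> R \<Longrightarrow> word_eq R u v"

definition presented_group ::
    "(('a \<times> bool) list \<times> ('a \<times> bool) list) set \<Rightarrow> ('a \<times> bool) list set monoid" where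
  "presented_group R =
     \<lparr>carrier = UNIV // {(u, v). word_eq R u v},
      mult = (\<lambda>A B. {w. \<exists>u\<in>A. \<exists>v\<in>B. word_eq R (u @ v) w}),
      one = {w. word_eq R [] w}\<rparr>"

definition thompson_F :: "(nat \<times> bool) list set monoid" where
  "thompson_F = presented_group
     {([(i, False), (j, True), (i, True)], [(j + 1, True)]) | i j. i < j}"


text \<open>
  The locale \<open>simple_group\<close> of HOL-Algebra asks for \<open>order G > 1\<close>, where \<open>order\<close> is a \<open>card\<close>;
  it therefore excludes all infinite groups and cannot be used here.
\<close>

definition is_simple :: "('a, 'b) monoid_scheme \<Rightarrow> bool" where
  "is_simple G \<longleftrightarrow> group G \<and> carrier G \<noteq> {\<one>\<^bsub>G\<^esub>} \<and>
     (\<forall>N. N \<lhd> G \<longrightarrow> N = carrier G \<or> N = {\<one>\<^bsub>G\<^esub>})"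


definition homeo_plus :: "(real \<Rightarrow> real) monoid" where
  "homeo_plus =
     \<lparr>carrier = {f. strict_mono f \<and> (\<exists>g. homeomorphism UNIV UNIV f g)},
      mult = (\<circ>), one = id\<rparr>"

abbreviation as_group :: "(real \<Rightarrow> real) set \<Rightarrow> (real \<Rightarrow> real) monoid" where
  "as_group G \<equiv> homeo_plus\<lparr>carrier := G\<rparr>"

definition supp :: "(real \<Rightarrow> real) \<Rightarrow> real set" where
  "supp f = {x. f x \<noteq> x}"

definition Supp :: "(real \<Rightarrow> real) set \<Rightarrow> real set" where
  "Supp G = (\<Union>g\<in>G. supp g)"

definition orbit :: "(real \<Rightarrow> real) set \<Rightarrow> real \<Rightarrow> real set" where
  "orbit G x = {g x | g. g \<in> G}"

definition orbit_closure :: "(real \<Rightarrow> real) set \<Rightarrow> real \<Rightarrow> real set" where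
  "orbit_closure G x = Abstract_Topology.closure_of (top_of_set (Supp G)) (orbit G x)"

definition acts_minimally :: "(real \<Rightarrow> real) set \<Rightarrow> bool" where
  "acts_minimally G \<longleftrightarrow> (\<forall>x\<in>Supp G. orbit_closure G x = Supp G)"


definition left_endpoint :: "real set \<Rightarrow> ereal" where
  "left_endpoint J = Inf (ereal ` J)"

definition chain_of_intervals :: "nat \<Rightarrow> (nat \<Rightarrow> real set) \<Rightarrow> bool" where
  "chain_of_intervals n J \<longleftrightarrow>
     (\<forall>i\<in>{1..n}. J i \<noteq> {} \<and> open (J i) \<and> is_interval (J i)) \<and>
     (\<forall>i\<in>{1..n}. \<forall>k\<in>{1..n}. \<bar>int i - int k\<bar> > 1 \<longrightarrow> J i \<inter> J k = {}) \<and>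
     (\<forall>i\<in>{1..<n}. J i \<inter> J (i + 1) \<noteq> {} \<and> is_interval (J i \<inter> J (i + 1)) \<and>
        J i \<inter> J (i + 1) \<subset> J i \<and> J i \<inter> J (i + 1) \<subset> J (i + 1))"

definition chain_group :: "nat \<Rightarrow> (real \<Rightarrow> real) set \<Rightarrow> bool" where
  "chain_group n G \<longleftrightarrow> n \<ge> 2 \<and>
     (\<exists>f :: nat \<Rightarrow> real \<Rightarrow> real.
        (\<forall>i\<in>{1..n}. f i \<in> carrier homeo_plus) \<and>
        G = generate homeo_plus (f ` {1..n}) \<and>
        chain_of_intervals n (\<lambda>i. supp (f i)) \<and>
        (\<forall>i\<in>{1..<n}. left_endpoint (supp (f i)) < left_endpoint (supp (f (i + 1)))) \<and>
        (\<forall>i\<in>{1..n}. \<forall>t. f i t \<ge> t) \<and>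
        (\<forall>i\<in>{1..<n}. as_group (generate homeo_plus {f i, f (i + 1)}) \<cong> thompson_F))"


definition perfect_in :: "'a topology \<Rightarrow> 'a set \<Rightarrow> bool" where
  "perfect_in X S \<longleftrightarrow> X derived_set_of S = S"

definition totally_disconnected :: "'a::topological_space set \<Rightarrow> bool" where
  "totally_disconnected S \<longleftrightarrow> (\<forall>T. T \<subseteq> S \<and> connected T \<longrightarrow> (\<forall>x\<in>T. \<forall>y\<in>T. x = y))"

definition Cantor_orbit :: "(real \<Rightarrow> real) set \<Rightarrow> real \<Rightarrow> bool" where
  "Cantor_orbit G x \<longleftrightarrow> perfect_in (top_of_set (Supp G)) (orbit_closure G x) \<and>
     totally_disconnected (orbit_closure G x)"

text \<open>
  The open interval \<open>Supp G\<close> plays the role of the line on which \<open>G\<close> acts, so \<open>h\<close> is defined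
  directly on it instead of on \<open>\<real>\<close> after a choice of identification of \<open>Supp G\<close> with \<open>\<real>\<close>;
  values of \<open>h\<close> outside \<open>Supp G\<close> are irrelevant.
\<close>

definition minimalization :: "(real \<Rightarrow> real) set \<Rightarrow> real set \<Rightarrow> (real \<Rightarrow> real)
    \<Rightarrow> ((real \<Rightarrow> real) \<Rightarrow> (real \<Rightarrow> real)) \<Rightarrow> bool" where
  "minimalization G \<Lambda> h \<Phi> \<longleftrightarrow>
     continuous_on (Supp G) h \<and> mono_on (Supp G) h \<and> h ` Supp G = UNIV \<and>
     (\<forall>C\<in>components (Supp G - \<Lambda>).
        \<exists>c. \<forall>y\<in>Abstract_Topology.closure_of (top_of_set (Supp G)) C. h y = c) \<and>
     \<Phi> \<in> hom (as_group G) homeo_plus \<and>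
     (\<forall>g\<in>G. \<forall>x\<in>Supp G. h (g x) = \<Phi> g (h x))"

end

theory Submission
  imports Defs
begin

text \<open>
  Every orbit enters the support \<open>J 1\<close> of the first generator and is pushed by \<open>f 1\<close> towards its
  right endpoint \<open>\<beta>\<close>, which lies in the support of the second generator. Hence every nonempty
  invariant closed set contains the orbit closure \<open>\<Lambda>\<close> of \<open>\<beta>\<close>, and either \<open>\<Lambda>\<close> is everything or it
  is perfect with empty interior.

  If the action is minimal, compact intervals can be moved into arbitrary open intervals (first into
  \<open>J 1\<close>, then towards \<open>\<beta>\<close>, then along the orbit of \<open>\<beta>\<close>), so by Higman's commutator argument a
  nontrivial normal subgroup \<open>N\<close> contains the commutators of all compactly supported elements. Two
  noncommuting elements of the commutator subgroup of \<open>\<langle>f i, f (i + 1)\<rangle> \<cong> F\<close> then give a nontrivial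
  element of \<open>N\<close> in this copy of \<open>F\<close>; as proper quotients of \<open>F\<close> are abelian, all generators commute
  modulo \<open>N\<close>. Simplicity of \<open>G'\<close> follows by the same argument applied to \<open>G'\<close>, which moves compact
  intervals as freely as \<open>G\<close> does.

  In general a monotone map collapsing the gaps of \<open>\<Lambda>\<close> semiconjugates \<open>G\<close> to a minimal action. It
  is injective on each \<open>\<langle>f i, f (i + 1)\<rangle>\<close>, since the images of \<open>f i\<close> and \<open>f (i + 1)\<close> do not commute.
  The closure of an orbit in a gap of \<open>\<Lambda>\<close> may be perfect and totally disconnected as well, so that
  \<open>orbit_closure G x\<close> can be larger than \<open>\<Lambda>\<close>; the collapse is always along \<open>\<Lambda>\<close>.
\<close>


section \<open>Proper quotients of Thompson's group\<close>

lemma (in group) commute_inv: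
  assumes "a \<in> carrier G" "b \<in> carrier G" "a \<otimes> b = b \<otimes> a"
  shows "a \<otimes> inv b = inv b \<otimes> a"
proof -
  have "inv b \<otimes> (a \<otimes> b) \<otimes> inv b = inv b \<otimes> (b \<otimes> a) \<otimes> inv b"
    using assms by simp
  then show ?thesis using assms(1,2) by (simp add: m_assoc inv_solve_left)
qed

lemma (in group) commute_mult:
  assumes "a \<in> carrier G" "b \<in> carrier G" "c \<in> carrier G" "a \<otimes> b = b \<otimes> a" "a \<otimes> c = c \<otimes> a"
  shows "a \<otimes> (b \<otimes> c) = (b \<otimes> c) \<otimes> a"
  using assms by (metis m_assoc)

lemma (in group) inv_conj:
  assumes "a \<in> carrier G" "b \<in> carrier G" "c \<in> carrier G" "a \<otimes> b = b \<otimes> c"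
  shows "c \<otimes> inv b = inv b \<otimes> a"
proof -
  have "inv b \<otimes> (b \<otimes> c) \<otimes> inv b = inv b \<otimes> (a \<otimes> b) \<otimes> inv b"
    using assms by simp
  moreover have "inv b \<otimes> (a \<otimes> b) \<otimes> inv b = inv b \<otimes> a" using assms(1,2) by (simp add: m_assoc)
  ultimately show ?thesis using assms(1-3) by (simp add: m_assoc[symmetric])
qed

text \<open>The relations of \<open>F\<close> are written without inverses, so that positive words
  can be rearranged. Since only the relations are asked for, the same words can be evaluated in
  \<open>F\<close> and in a quotient of \<open>F\<close>.\<close>

locale thompson_sequence = group L for L (structure) +
  fixes X :: "nat \<Rightarrow> 'a"
  assumes X_closed [simp]: "X i \<in> carrier L"
    and X_rel: "i < j \<Longrightarrow> X j \<otimes> X i = X i \<otimes> X (Suc j)"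
begin

definition ev :: "nat list \<Rightarrow> 'a" where
  "ev w = foldr (\<lambda>i y. X i \<otimes> y) w \<one>"

lemma ev_simps [simp]: "ev [] = \<one>" "ev (i # w) = X i \<otimes> ev w"
  by (simp_all add: ev_def)

lemma ev_closed [simp]: "ev w \<in> carrier L"
  by (induction w) auto

lemma ev_append: "ev (v @ w) = ev v \<otimes> ev w"
  by (induction v) (auto simp: m_assoc)

lemma X_pow: "i < j \<Longrightarrow> X j \<otimes> X i [^] m = X i [^] m \<otimes> X (j + m)"
proof (induction m)
  case (Suc m)
  have "X j \<otimes> X i [^] Suc m = (X i [^] m \<otimes> X (j + m)) \<otimes> X i"
    using Suc by (simp add: m_assoc[symmetric])
  also have "\<dots> = X i [^] m \<otimes> (X i \<otimes> X (Suc (j + m)))"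
    using X_rel[of i "j + m"] Suc.prems by (simp add: m_assoc)
  finally show ?case by (simp add: m_assoc)
qed simp

text \<open>Moving \<open>X i\<close> to the left past larger letters raises each of their indices
  by one; \<open>quotient_collapse\<close> uses this to push all letters beyond
  \<open>Suc i\<close>.\<close>

lemma ev_shift:
  "\<forall>j\<in>set w. i < j \<Longrightarrow> ev w \<otimes> X i = X i \<otimes> ev (map Suc w)"
proof (induction w)
  case (Cons j w)
  have "ev (j # w) \<otimes> X i = X j \<otimes> X i \<otimes> ev (map Suc w)"
    using Cons by (simp add: m_assoc)
  also have "\<dots> = X i \<otimes> (X (Suc j) \<otimes> ev (map Suc w))"
    using X_rel[of i j] Cons.prems by (simp add: m_assoc)
  finally show ?case by simp
qed simp

end

text \<open>\<open>pull\<close> moves all letters \<open>i\<close> of a positive word to the front; being defined on words, it acts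
  in the same way on \<open>F\<close> and on a quotient of it.\<close>

fun pull :: "nat \<Rightarrow> nat list \<Rightarrow> nat \<times> nat list" where
  "pull i [] = (0, [])"
| "pull i (j # w) = (let (m, u) = pull i w in if j = i then (Suc m, u) else (m, (j + m) # u))"

text \<open>The length equation makes the induction in \<open>positive_words_descent\<close> work:
  taking out the letters \<open>i\<close> shortens the words.\<close>

lemma pull_props:
  "pull i w = (m, u) \<Longrightarrow> \<forall>j\<in>set w. i \<le> j \<Longrightarrow> (\<forall>j\<in>set u. i < j) \<and> length w = m + length u"
proof (induction w arbitrary: m u)
  case (Cons j w)
  obtain m' u' where p: "pull i w = (m', u')" by fastforce
  show ?case using Cons.IH[OF p] Cons.prems p by (auto split: if_splits)
qed auto

lemma pull_pos: "pull i w = (m, u) \<Longrightarrow> i \<in> set w \<Longrightarrow> 0 < m"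
  by (induction w arbitrary: m u) (auto split: if_splits prod.splits)

context thompson_sequence
begin

text \<open>By \<open>X_pow\<close>, a letter \<open>j\<close> in front of \<open>m\<close> letters
  \<open>i\<close> comes to stand behind them as \<open>j + m\<close>; this is the shift in
  \<open>pull\<close>.\<close>

lemma ev_pull:
  "pull i w = (m, u) \<Longrightarrow> \<forall>j\<in>set w. i \<le> j \<Longrightarrow> ev w = X i [^] m \<otimes> ev u"
proof (induction w arbitrary: m u)
  case (Cons j w)
  obtain m' u' where p: "pull i w = (m', u')" by fastforce
  then have IH: "ev w = X i [^] m' \<otimes> ev u'" using Cons by auto
  show ?case
  proof (cases "j = i")
    case True
    then have "m = Suc m'" "u = u'" using Cons.prems p by auto
    moreover have "X i \<otimes> X i [^] m' = X i [^] Suc m'" by (metis X_closed nat_pow_Suc2)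
    ultimately show ?thesis using True IH by (simp add: m_assoc[symmetric])
  next
    case False
    then have "m = m'" "u = (j + m') # u'" using Cons.prems p by auto
    then show ?thesis using False IH X_pow[of i j m'] Cons.prems by (simp add: m_assoc[symmetric])
  qed
qed auto

text \<open>The inverse letter travels to the right through the positive word. It cancels against an
  equal letter, raises the index of a smaller-indexed inverse's larger neighbour, or has its own
  index raised by a smaller letter; hence the induction is over all \<open>j\<close>. If it
  survives, it becomes the denominator.\<close>

lemma inv_X_ev:
  "\<exists>p q. inv X j \<otimes> ev w = ev p \<otimes> inv ev q"
proof (induction w arbitrary: j)
  case Nil
  show ?case by (rule exI[of _ "[]"], rule exI[of _ "[j]"]) simp
next
  case (Cons i w)
  consider "i = j" | "j < i" | "i < j" by linarith
  then show ?case
  proof cases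
    case 1
    have "inv X j \<otimes> ev (i # w) = ev w \<otimes> inv ev []"
      using 1 by (simp add: m_assoc[symmetric])
    then show ?thesis by blast
  next
    case 2
    have "inv X j \<otimes> X i = X (Suc i) \<otimes> inv X j"
      using X_rel[OF 2] by (simp add: m_assoc inv_solve_left inv_solve_right)
    then have "inv X j \<otimes> ev (i # w) = X (Suc i) \<otimes> (inv X j \<otimes> ev w)"
      by (simp add: m_assoc[symmetric])
    moreover obtain p q where "inv X j \<otimes> ev w = ev p \<otimes> inv ev q" using Cons by blast
    ultimately have "inv X j \<otimes> ev (i # w) = ev (Suc i # p) \<otimes> inv ev q" by (simp add: m_assoc)
    then show ?thesis by blast
  next
    case 3
    have "inv X j \<otimes> X i = X i \<otimes> inv X (Suc j)"
    proof -
      have "X i = inv X j \<otimes> (X i \<otimes> X (Suc j))"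
        using inv_solve_left[of "X i" "X j" "X i \<otimes> X (Suc j)"] X_rel[OF 3] by simp
      then have "X i \<otimes> inv X (Suc j) = inv X j \<otimes> (X i \<otimes> X (Suc j)) \<otimes> inv X (Suc j)"
        by (rule arg_cong)
      also have "\<dots> = inv X j \<otimes> (X i \<otimes> (X (Suc j) \<otimes> inv X (Suc j)))"
        by (simp add: m_assoc del: r_inv)
      finally show ?thesis by simp
    qed
    then have "inv X j \<otimes> ev (i # w) = X i \<otimes> (inv X (Suc j) \<otimes> ev w)"
      by (simp add: m_assoc[symmetric])
    moreover obtain p q where "inv X (Suc j) \<otimes> ev w = ev p \<otimes> inv ev q" using Cons by blast
    ultimately have "inv X j \<otimes> ev (i # w) = ev (i # p) \<otimes> inv ev q" by (simp add: m_assoc)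
    then show ?thesis by blast
  qed
qed

text \<open>Multiplying the equation by \<open>X i\<close> on the right shifts \<open>u\<close> and
  \<open>v\<close> beyond \<open>Suc i\<close> and keeps the power of \<open>X i\<close>, which is
  thus a fraction of letters beyond \<open>Suc i\<close>. Such letters are conjugated alike by
  \<open>X i\<close> and \<open>X (Suc i)\<close>; so \<open>X i [^] m\<close> commutes with
  \<open>X (Suc i)\<close>, and this makes generators coincide.\<close>

lemma quotient_collapse:
  fixes m :: nat
  assumes "0 < m" "\<forall>j\<in>set u. i < j" "\<forall>j\<in>set v. i < j" and eq: "X i [^] m \<otimes> ev u = ev v"
  shows "X j \<otimes> X k = X k \<otimes> X j"
proof -
  define u' v' where "u' = map Suc u" and "v' = map Suc v"
  have "X i \<otimes> (X i [^] m \<otimes> ev u') = X i [^] m \<otimes> X i \<otimes> ev u'"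
    using nat_pow_Suc2[of "X i" m] by (simp add: m_assoc[symmetric])
  also have "\<dots> = X i [^] m \<otimes> (ev u \<otimes> X i)"
    using ev_shift[of u i] assms by (simp add: m_assoc u'_def)
  also have "\<dots> = ev v \<otimes> X i" by (simp add: m_assoc[symmetric] eq)
  also have "\<dots> = X i \<otimes> ev v'" using ev_shift[of v i] assms by (simp add: v'_def)
  finally have "X i [^] m \<otimes> ev u' = ev v'" by simp
  then have pw: "X i [^] m = ev v' \<otimes> inv ev u'" by (metis inv_solve_right ev_closed nat_pow_closed X_closed)
  \<comment> \<open>\<open>X i\<close> and \<open>X (Suc i)\<close> both conjugate
    \<open>X j\<close> to \<open>X (Suc j)\<close> for \<open>j > Suc i\<close>, so their quotient
    centralizes all these letters.\<close>
  define y where "y = X i \<otimes> inv X (Suc i)"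
  have y[simp]: "y \<in> carrier L" by (simp add: y_def)
  have yX: "y \<otimes> X j = X j \<otimes> y" if "Suc i < j" for j
  proof -
    have "X (Suc j) \<otimes> inv X (Suc i) = inv X (Suc i) \<otimes> X j"
      using X_rel[of "Suc i" j] that by (intro inv_conj) auto
    moreover have "X j \<otimes> X i = X i \<otimes> X (Suc j)" using X_rel[of i j] that by simp
    ultimately show ?thesis unfolding y_def by (metis m_assoc X_closed inv_closed)
  qed
  have yev: "y \<otimes> ev w = ev w \<otimes> y" if "\<forall>j\<in>set w. Suc i < j" for w
    using that by (induction w) (auto intro!: commute_mult yX)
  have "y \<otimes> ev u' = ev u' \<otimes> y" "y \<otimes> ev v' = ev v' \<otimes> y"
    using assms by (auto intro!: yev simp: u'_def v'_def)
  then have "y \<otimes> X i [^] m = X i [^] m \<otimes> y"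
    unfolding pw by (intro commute_mult commute_inv) auto
  then have c1: "X i [^] m \<otimes> inv y = inv y \<otimes> X i [^] m"
    by (intro commute_inv) auto
  have c2: "X i [^] m \<otimes> X i = X i \<otimes> X i [^] m"
    by (metis X_closed nat_pow_Suc nat_pow_Suc2)
  have "X (Suc i) = inv y \<otimes> X i" by (simp add: y_def inv_mult_group m_assoc)
  then have "X i [^] m \<otimes> X (Suc i) = X (Suc i) \<otimes> X i [^] m"
    using commute_mult[OF _ _ _ c1 c2] by simp
  also have "\<dots> = X i [^] m \<otimes> X (Suc i + m)" by (rule X_pow) simp
  finally have e1: "X (Suc i) = X (Suc i + m)" by simp
  \<comment> \<open>Because of \<open>0 < m\<close> there is a relation between
    \<open>X (Suc i)\<close> and \<open>X (Suc i + m)\<close>; as these are equal, it identifies two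
    consecutive generators.\<close>
  have "X (Suc i + m) \<otimes> X (Suc i) = X (Suc i) \<otimes> X (Suc (Suc i + m))"
    by (rule X_rel) (use assms in simp)
  then have "X (Suc i) \<otimes> X (Suc i) = X (Suc i) \<otimes> X (Suc (Suc i + m))"
    using e1[symmetric] by simp
  then have "X (Suc i) = X (Suc (Suc i + m))" by simp
  then have e2: "X (Suc (i + m)) = X (Suc (Suc (i + m)))" using e1 by simp
  \<comment> \<open>Cancelling \<open>X 0\<close> lowers the indices of two equal consecutive
    generators down to \<open>X 1 = X 2\<close>. Climbing up again, \<open>e\<close> leaves only
    \<open>X 0\<close> and \<open>X 1\<close> as possible values.\<close>
  have down: "X (Suc l) = X (Suc (Suc l)) \<Longrightarrow> X 1 = X 2" for l
  proof (induction l)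
    case (Suc l)
    have "X (Suc l) \<otimes> X 0 = X (Suc (Suc l)) \<otimes> X 0"
      using X_rel[of 0 "Suc l"] X_rel[of 0 "Suc (Suc l)"] Suc.prems by simp
    then show ?case using Suc.IH by simp
  qed (simp add: numeral_2_eq_2)
  have e: "X (Suc l) = X 1" for l
  proof (induction l)
    case (Suc l)
    have "X 0 \<otimes> X (Suc (Suc l)) = X 0 \<otimes> X 2"
      using X_rel[of 0 "Suc l"] X_rel[of 0 1] Suc by (simp add: numeral_2_eq_2)
    then show ?case using down[OF e2] by simp
  qed simp
  have "X 1 \<otimes> X 0 = X 0 \<otimes> X 1"
    using X_rel[of 0 1] down[OF e2] by (simp add: numeral_2_eq_2)
  then have c: "X 0 \<otimes> X 1 = X 1 \<otimes> X 0" by simp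
  have "X l = X 0 \<or> X l = X 1" for l
    by (cases l) (use e in blast)+
  from this[of j] this[of k] show ?thesis
    by (elim disjE) (simp_all only: c)
qed

end

text \<open>Pull the smallest letter to the front of both words. Equal exponents can be cancelled in
  both groups and leave a shorter pair that still differs in \<open>K\<close> and agrees in
  \<open>L\<close>; unequal exponents leave an equation in \<open>L\<close> to which
  \<open>quotient_collapse\<close> applies.\<close>

lemma positive_words_descent:
  assumes K: "thompson_sequence K x" and L: "thompson_sequence L y"
    and "thompson_sequence.ev K x p \<noteq> thompson_sequence.ev K x q"
    and "thompson_sequence.ev L y p = thompson_sequence.ev L y q"
  shows "y j \<otimes>\<^bsub>L\<^esub> y k = y k \<otimes>\<^bsub>L\<^esub> y j"
  using assms(3,4)
proof (induction "length p + length q" arbitrary: p q rule: less_induct)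
  case less
  interpret K: thompson_sequence K x by (rule K)
  interpret L: thompson_sequence L y by (rule L)
  \<comment> \<open>The minimum is over both words, so that \<open>pull\<close> applies to both and
    shortens at least one.\<close>
  define i where "i = Min (set p \<union> set q)"
  have ne: "set p \<union> set q \<noteq> {}" using less.prems(1) by auto
  have le: "\<forall>j\<in>set p. i \<le> j" "\<forall>j\<in>set q. i \<le> j" by (auto simp: i_def)
  have i: "i \<in> set p \<or> i \<in> set q" using Min_in[OF _ ne] by (auto simp: i_def)
  obtain m u where pu: "pull i p = (m, u)" by fastforce
  obtain l v where qv: "pull i q = (l, v)" by fastforce
  note u = pull_props[OF pu le(1)] and v = pull_props[OF qv le(2)]
  have pos: "0 < m \<or> 0 < l" using i pull_pos[OF pu] pull_pos[OF qv] by blast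
  have Leq: "y i [^]\<^bsub>L\<^esub> m \<otimes>\<^bsub>L\<^esub> L.ev u = y i [^]\<^bsub>L\<^esub> l \<otimes>\<^bsub>L\<^esub> L.ev v"
    using less.prems(2) L.ev_pull[OF pu le(1)] L.ev_pull[OF qv le(2)] by simp
  have Kne: "x i [^]\<^bsub>K\<^esub> m \<otimes>\<^bsub>K\<^esub> K.ev u \<noteq> x i [^]\<^bsub>K\<^esub> l \<otimes>\<^bsub>K\<^esub> K.ev v"
    using less.prems(1) K.ev_pull[OF pu le(1)] K.ev_pull[OF qv le(2)] by simp
  consider "l = m" | "l < m" | "m < l" by linarith
  then show ?case
  proof cases
    case 1
    show ?thesis
    proof (rule less.hyps)
      show "length u + length v < length p + length q" using u v pos 1 by simp
      show "K.ev u \<noteq> K.ev v" using Kne 1 by auto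
      show "L.ev u = L.ev v" using Leq 1 by simp
    qed
  next
    case 2
    have "y i [^]\<^bsub>L\<^esub> m = y i [^]\<^bsub>L\<^esub> l \<otimes>\<^bsub>L\<^esub> y i [^]\<^bsub>L\<^esub> (m - l)"
      using 2 by (simp add: L.nat_pow_mult)
    then have "y i [^]\<^bsub>L\<^esub> (m - l) \<otimes>\<^bsub>L\<^esub> L.ev u = L.ev v" using Leq by (simp add: L.m_assoc)
    from L.quotient_collapse[OF _ _ _ this] show ?thesis using 2 u v by simp
  next
    case 3
    have "y i [^]\<^bsub>L\<^esub> l = y i [^]\<^bsub>L\<^esub> m \<otimes>\<^bsub>L\<^esub> y i [^]\<^bsub>L\<^esub> (l - m)"
      using 3 by (simp add: L.nat_pow_mult)
    then have "y i [^]\<^bsub>L\<^esub> (l - m) \<otimes>\<^bsub>L\<^esub> L.ev v = L.ev u" using Leq by (simp add: L.m_assoc)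
    from L.quotient_collapse[OF _ _ _ this] show ?thesis using 3 u v by simp
  qed
qed

section \<open>From the presentation of Thompson's group to words\<close>

lemma presented_group_mult_class:
  "{w. word_eq R u w} \<otimes>\<^bsub>presented_group R\<^esub> {w. word_eq R v w} = {w. word_eq R (u @ v) w}"
  by (auto simp: presented_group_def
      intro: word_eq.trans word_eq.append word_eq.refl word_eq.sym)

text \<open>\<open>k w\<close> is the element of \<open>K\<close> corresponding to the class of the
  word \<open>w\<close>; what follows uses only these properties and no classes of words.\<close>

lemma iso_thompson_F_words:
  assumes "group K" "K \<cong> thompson_F"
  obtains k :: "(nat \<times> bool) list \<Rightarrow> 'a"
  where "\<And>w. k w \<in> carrier K" "\<And>u v. k (u @ v) = k u \<otimes>\<^bsub>K\<^esub> k v" "carrier K = range k"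
    "\<And>i. k [(i, False)] = inv\<^bsub>K\<^esub> k [(i, True)]"
    "\<And>i j. i < j \<Longrightarrow> k [(i, False), (j, True), (i, True)] = k [(j + 1, True)]"
proof -
  interpret group K by fact
  define R :: "((nat \<times> bool) list \<times> (nat \<times> bool) list) set" where
    "R = {([(i, False), (j, True), (i, True)], [(j + 1, True)]) | i j. i < j}"
  have F: "thompson_F = presented_group R" by (simp add: thompson_F_def R_def)
  define cls where "cls u = {w. word_eq R u w}" for u
  obtain h where h: "h \<in> hom K thompson_F" and bij: "bij_betw h (carrier K) (carrier thompson_F)"
    using assms(2) by (auto simp: is_iso_def iso_def)
  have carF: "carrier thompson_F = range cls"
    by (auto simp: F presented_group_def cls_def quotient_def)
  define k where "k w = inv_into (carrier K) h (cls w)" for w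
  have kc: "k w \<in> carrier K" and hk: "h (k w) = cls w" for w
    using bij carF by (auto simp: k_def bij_betw_def intro!: inv_into_into f_inv_into_f)
  have inj: "x = y" if "x \<in> carrier K" "y \<in> carrier K" "h x = h y" for x y
    using bij that by (auto simp: bij_betw_def inj_on_def)
  have app: "k (u @ v) = k u \<otimes>\<^bsub>K\<^esub> k v" for u v
    using h kc hk presented_group_mult_class[of R u v]
    by (intro inj) (auto simp: hom_def cls_def F)
  have eq: "k u = k v" if "word_eq R u v" for u v
  proof -
    have "cls u = cls v"
      using that unfolding cls_def by (blast intro: word_eq.sym word_eq.trans)
    then show ?thesis by (simp add: k_def)
  qed
  have range: "carrier K = range k"
  proof
    show "carrier K \<subseteq> range k"
    proof
      fix x assume x: "x \<in> carrier K"
      then have "h x \<in> range cls" using bij carF by (metis bij_betw_def imageI)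
      then obtain w where "h x = cls w" by blast
      then have "x = k w" using x kc hk by (intro inj) auto
      then show "x \<in> range k" by simp
    qed
  qed (use kc in auto)
  have one: "k [] = \<one>\<^bsub>K\<^esub>" using app[of "[]" "[]"] kc[of "[]"] by simp
  have inv: "k [(i, False)] = inv\<^bsub>K\<^esub> k [(i, True)]" for i
    using app[of "[(i, False)]" "[(i, True)]"] eq[OF word_eq.cancel[of R i False]] one kc
    by (simp add: inv_equality)
  have rel: "k [(i, False), (j, True), (i, True)] = k [(j + 1, True)]" if "i < j" for i j
    using that by (intro eq word_eq.relation) (auto simp: R_def)
  show ?thesis by (rule that[OF kc app range inv rel])
qed

text \<open>A nontrivial kernel element is a fraction of two positive words that differ in
  \<open>K\<close> and agree in \<open>L\<close>; by \<open>positive_words_descent\<close> the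
  images of the generators commute.\<close>

theorem thompson_F_proper_quotient_abelian:
  assumes "group K" "K \<cong> thompson_F" "group L" and \<phi>: "\<phi> \<in> hom K L"
    and g: "g \<in> carrier K" "g \<noteq> \<one>\<^bsub>K\<^esub>" "\<phi> g = \<one>\<^bsub>L\<^esub>"
    and ab: "a \<in> carrier K" "b \<in> carrier K"
  shows "\<phi> a \<otimes>\<^bsub>L\<^esub> \<phi> b = \<phi> b \<otimes>\<^bsub>L\<^esub> \<phi> a"
proof -
  interpret K: group K by fact
  interpret L: group L by fact
  interpret \<phi>: group_hom K L \<phi> using \<phi> by unfold_locales
  obtain k :: "(nat \<times> bool) list \<Rightarrow> 'a" where kc: "\<And>w. k w \<in> carrier K" and app: "\<And>u v. k (u @ v) = k u \<otimes>\<^bsub>K\<^esub> k v"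
    and range: "carrier K = range k" and kinv: "\<And>i. k [(i, False)] = inv\<^bsub>K\<^esub> k [(i, True)]"
    and rel: "\<And>i j. i < j \<Longrightarrow> k [(i, False), (j, True), (i, True)] = k [(j + 1, True)]"
  proof (rule iso_thompson_F_words[OF assms(1,2)], goal_cases)
    case (1 k)
    from 1(1)[of k, OF 1(2-6)] show ?case .
  qed
  define x where "x i = k [(i, True)]" for i
  have x[simp]: "x i \<in> carrier K" for i by (simp add: x_def kc)
  have one: "k [] = \<one>\<^bsub>K\<^esub>" using app[of "[]" "[]"] kc[of "[]"] by simp
  have xrel: "x j \<otimes>\<^bsub>K\<^esub> x i = x i \<otimes>\<^bsub>K\<^esub> x (Suc j)" if "i < j" for i j
  proof -
    have "inv\<^bsub>K\<^esub> x i \<otimes>\<^bsub>K\<^esub> (x j \<otimes>\<^bsub>K\<^esub> x i) = x (Suc j)"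
      using rel[OF that] app[of "[(i, False)]" "[(j, True), (i, True)]"]
        app[of "[(j, True)]" "[(i, True)]"] by (simp add: kinv x_def)
    then show ?thesis using K.inv_solve_left[of "x (Suc j)" "x i" "x j \<otimes>\<^bsub>K\<^esub> x i"] by simp
  qed
  interpret TK: thompson_sequence K x by unfold_locales (auto intro: xrel)
  interpret TL: thompson_sequence L "\<lambda>i. \<phi> (x i)"
    by unfold_locales (use xrel in \<open>auto simp flip: \<phi>.hom_mult\<close>)
  have \<phi>ev: "\<phi> (TK.ev w) = TL.ev w" for w by (induction w) auto
  have letter: "k [l] = x (fst l) \<or> k [l] = inv\<^bsub>K\<^esub> x (fst l)" for l
    by (cases l; cases "snd l") (auto simp: x_def kinv)
  have kCons: "k (l # w) = k [l] \<otimes>\<^bsub>K\<^esub> k w" for l w using app[of "[l]" w] by simp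
  \<comment> \<open>Fractions of positive words: letters are added on the left, and an inverse one
    passes through the numerator by \<open>inv_X_ev\<close>.\<close>
  have "\<exists>p q. k w = TK.ev p \<otimes>\<^bsub>K\<^esub> inv\<^bsub>K\<^esub> TK.ev q" for w
  proof (induction w)
    case Nil
    show ?case by (rule exI[of _ "[]"], rule exI[of _ "[]"]) (simp add: one)
  next
    case (Cons l w)
    then obtain p q where pq: "k w = TK.ev p \<otimes>\<^bsub>K\<^esub> inv\<^bsub>K\<^esub> TK.ev q" by blast
    from letter[of l] show ?case
    proof
      assume "k [l] = x (fst l)"
      then have "k (l # w) = TK.ev (fst l # p) \<otimes>\<^bsub>K\<^esub> inv\<^bsub>K\<^esub> TK.ev q"
        using pq kCons[of l w] by (simp add: K.m_assoc)
      then show ?thesis by blast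
    next
      assume l: "k [l] = inv\<^bsub>K\<^esub> x (fst l)"
      obtain p' q' where p': "inv\<^bsub>K\<^esub> x (fst l) \<otimes>\<^bsub>K\<^esub> TK.ev p = TK.ev p' \<otimes>\<^bsub>K\<^esub> inv\<^bsub>K\<^esub> TK.ev q'"
        using TK.inv_X_ev by blast
      have "k (l # w) = (inv\<^bsub>K\<^esub> x (fst l) \<otimes>\<^bsub>K\<^esub> TK.ev p) \<otimes>\<^bsub>K\<^esub> inv\<^bsub>K\<^esub> TK.ev q"
        using pq kCons[of l w] l by (simp add: K.m_assoc)
      also have "\<dots> = TK.ev p' \<otimes>\<^bsub>K\<^esub> inv\<^bsub>K\<^esub> (TK.ev (q @ q'))"
        by (simp add: p' TK.ev_append K.m_assoc K.inv_mult_group)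
      finally show ?thesis by blast
    qed
  qed
  moreover obtain w where "g = k w" using g(1) unfolding range by blast
  ultimately obtain p q where pq: "g = TK.ev p \<otimes>\<^bsub>K\<^esub> inv\<^bsub>K\<^esub> TK.ev q" by metis
  have "TK.ev p \<noteq> TK.ev q" using g(2) pq by auto
  moreover have "TL.ev p = TL.ev q"
  proof -
    have "TL.ev p \<otimes>\<^bsub>L\<^esub> inv\<^bsub>L\<^esub> TL.ev q = \<one>\<^bsub>L\<^esub>"
      using g(3) pq \<phi>ev by simp
    then show ?thesis by (metis L.inv_equality L.inv_inv L.inv_closed TL.ev_closed)
  qed
  ultimately have comm: "\<phi> (x j) \<otimes>\<^bsub>L\<^esub> \<phi> (x l) = \<phi> (x l) \<otimes>\<^bsub>L\<^esub> \<phi> (x j)" for j l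
    by (intro positive_words_descent) unfold_locales
  have 1: "\<phi> (x j) \<otimes>\<^bsub>L\<^esub> \<phi> (k w) = \<phi> (k w) \<otimes>\<^bsub>L\<^esub> \<phi> (x j)" for j w
  proof (induction w)
    case (Cons l w)
    have "\<phi> (x j) \<otimes>\<^bsub>L\<^esub> \<phi> (k [l]) = \<phi> (k [l]) \<otimes>\<^bsub>L\<^esub> \<phi> (x j)"
      using letter[of l] comm by (auto intro!: L.commute_inv)
    then show ?case using Cons kCons[of l w] kc by (auto intro!: L.commute_mult)
  qed (simp add: one)
  have "\<phi> (k v) \<otimes>\<^bsub>L\<^esub> \<phi> (k w) = \<phi> (k w) \<otimes>\<^bsub>L\<^esub> \<phi> (k v)" for v w
  proof (induction w)
    case (Cons l w)
    have "\<phi> (k v) \<otimes>\<^bsub>L\<^esub> \<phi> (k [l]) = \<phi> (k [l]) \<otimes>\<^bsub>L\<^esub> \<phi> (k v)"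
      using letter[of l] 1[symmetric] kc by (auto intro!: L.commute_inv)
    then show ?case using Cons kCons[of l w] kc by (auto intro!: L.commute_mult)
  qed (simp add: one kc)
  then show ?thesis using ab range by auto
qed

section \<open>Collapsing the gaps of a perfect set\<close>

text \<open>A point set \<open>P\<close> without isolated points induces the dense strict weak order
  \<open>x \<ll> y\<close> iff some point of \<open>P\<close> lies strictly between \<open>x\<close> and \<open>y\<close>. The map \<open>D\<close> places classes
  of this order at the dyadic rationals \<open>j / 2 ^ m\<close>, always inserting the first admissible point
  of an enumeration \<open>e\<close>, so that every enumerated class is eventually placed.\<close>

locale collapse =
  fixes I P :: "real set" and e :: "nat \<Rightarrow> real" and base :: "int \<Rightarrow> real"
  assumes I: "is_interval I"
    and no_isolated: "\<And>p a b. p \<in> P \<Longrightarrow> a < p \<Longrightarrow> p < b \<Longrightarrow> \<exists>q\<in>P. q \<noteq> p \<and> a < q \<and> q < b"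
    and e_I: "range e \<subseteq> I"
    and e_dense: "\<And>a b. a \<in> I \<Longrightarrow> b \<in> I \<Longrightarrow> a < b \<Longrightarrow> \<exists>k. a < e k \<and> e k < b"
    and base_I: "range base \<subseteq> I"
    and base_P: "\<And>j. \<exists>p\<in>P. base j < p \<and> p < base (j + 1)"
    and base_cofinal: "\<And>x. x \<in> I \<Longrightarrow> \<exists>j. x < base j"
    and base_coinitial: "\<And>x. x \<in> I \<Longrightarrow> \<exists>j. base j < x"
begin

definition prec :: "real \<Rightarrow> real \<Rightarrow> bool" (infix "\<ll>" 50) where
  "x \<ll> y \<longleftrightarrow> (\<exists>p\<in>P. x < p \<and> p < y)"

lemma prec_less: "x \<ll> y \<Longrightarrow> x < y"
  by (auto simp: prec_def)

lemma prec_le_trans: "x \<ll> y \<Longrightarrow> y \<le> z \<Longrightarrow> x \<ll> z"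
  by (force simp: prec_def)

lemma le_prec_trans: "x \<le> y \<Longrightarrow> y \<ll> z \<Longrightarrow> x \<ll> z"
  by (force simp: prec_def)

lemma prec_trans: "x \<ll> y \<Longrightarrow> y \<ll> z \<Longrightarrow> x \<ll> z"
  using prec_less prec_le_trans by fastforce

lemma prec_asym: "x \<ll> y \<Longrightarrow> \<not> y \<ll> x"
  using prec_less less_asym by blast

text \<open>If \<open>y\<close> is itself the separating point, a second point of \<open>P\<close>
  close to it separates \<open>y\<close> from \<open>x\<close> or from \<open>z\<close>; here
  isolated points must be excluded.\<close>

lemma prec_total: "x \<ll> z \<Longrightarrow> x \<ll> y \<or> y \<ll> z"
proof -
  assume "x \<ll> z"
  then obtain p where p: "p \<in> P" "x < p" "p < z" by (auto simp: prec_def)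
  show ?thesis
  proof (cases "y = p")
    case True
    obtain q where "q \<in> P" "q \<noteq> p" "x < q" "q < z" using no_isolated[OF p] by blast
    then show ?thesis using True by (cases q p rule: linorder_cases) (auto simp: prec_def)
  next
    case False
    then show ?thesis using p by (cases y p rule: linorder_cases) (auto simp: prec_def)
  qed
qed

text \<open>Between two points of \<open>P\<close> there is room for an enumerated point, which then
  has a point of \<open>P\<close> on either side.\<close>

lemma prec_dense:
  assumes "x \<in> I" "y \<in> I" "x \<ll> y"
  shows "\<exists>k. x \<ll> e k \<and> e k \<ll> y"
proof -
  obtain p where p: "p \<in> P" "x < p" "p < y" using assms by (auto simp: prec_def)
  obtain q where q: "q \<in> P" "q \<noteq> p" "x < q" "q < y" using no_isolated[OF p] by blast
  have *: ?thesis if A: "p \<in> P" "q \<in> P" "x < p" "p < q" "q < y" for p q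
  proof -
    have "p \<in> I" "q \<in> I"
      using I assms(1,2) that unfolding is_interval_1 by (meson less_imp_le less_trans)+
    then obtain k where "p < e k" "e k < q" using e_dense A by blast
    then show ?thesis using A by (auto simp: prec_def)
  qed
  show ?thesis using *[of p q] *[of q p] p q by (metis linorder_neqE)
qed

definition mid_index :: "real \<Rightarrow> real \<Rightarrow> nat" where
  "mid_index x y = (LEAST k. x \<ll> e k \<and> e k \<ll> y)"

fun D :: "nat \<Rightarrow> int \<Rightarrow> real" where
  "D 0 j = base j"
| "D (Suc m) j = (if even j then D m (j div 2)
     else e (mid_index (D m (j div 2)) (D m (j div 2 + 1))))"

lemma D_step: "D m j \<in> I \<and> D m j \<ll> D m (j + 1)"
proof (induction m arbitrary: j)
  case 0
  then show ?case using base_I base_P by (auto simp: prec_def)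
next
  case (Suc m)
  define l r where "l = D m (j div 2)" and "r = D m (j div 2 + 1)"
  have "l \<in> I" "r \<in> I" "l \<ll> r" using Suc by (auto simp: l_def r_def)
  from LeastI_ex[OF prec_dense[OF this]]
  have "l \<ll> e (mid_index l r) \<and> e (mid_index l r) \<ll> r" by (simp add: mid_index_def)
  then show ?case using Suc e_I
    by (cases "even j") (auto simp: l_def r_def elim!: evenE oddE)
qed

lemma D_I: "D m j \<in> I"
  using D_step by blast

lemma D_mono: "i < j \<Longrightarrow> D m i \<ll> D m j"
proof (induction j rule: int_gr_induct)
  case base
  then show ?case using D_step by blast
next
  case (step j)
  then show ?case using D_step prec_trans by blast
qed

lemma D_refine: "D (m + k) (2 ^ k * j) = D m j"
  by (induction k) (auto simp: mult.assoc)

lemma D_base: "D m (2 ^ m * j) = base j"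
  using D_refine[of 0 m j] by simp

lemma D_bracket:
  assumes "x \<in> I"
  obtains j where "\<not> x \<ll> D m j" "x \<ll> D m (j + 1)"
proof -
  obtain a where a: "x < base a" using base_cofinal assms by blast
  obtain b where b: "base b < x" using base_coinitial assms by blast
  \<comment> \<open>One base step beyond \<open>a\<close>, because \<open>x < base a\<close> alone
    provides no point of \<open>P\<close> in between.\<close>
  have a': "x \<ll> D m (2 ^ m * (a + 1))"
    using base_P[of a] a by (intro le_prec_trans[of x "base a"]) (auto simp: prec_def D_base)
  have b': "\<not> x \<ll> D m (2 ^ m * b)" using b prec_less D_base by fastforce
  define S where "S = {n::nat. x \<ll> D m (2 ^ m * b + int n)}"
  have "2 ^ m * b \<le> 2 ^ m * (a + 1)"
    using a' b' D_mono[of "2 ^ m * (a + 1)" "2 ^ m * b" m] prec_trans by (meson not_le)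
  then have "nat (2 ^ m * (a + 1) - 2 ^ m * b) \<in> S" using a' by (simp add: S_def)
  then have "(LEAST n. n \<in> S) \<in> S" by (rule LeastI)
  moreover have "0 \<notin> S" using b' by (simp add: S_def)
  ultimately obtain n where n: "(LEAST n. n \<in> S) = Suc n" by (metis not0_implies_Suc)
  then have "n \<notin> S" using not_less_Least[of n "\<lambda>n. n \<in> S"] by simp
  moreover have "Suc n \<in> S" using n \<open>(LEAST n. n \<in> S) \<in> S\<close> by simp
  ultimately show ?thesis by (intro that[of "2 ^ m * b + int n"]) (auto simp: S_def add_ac)
qed

text \<open>Each refinement of a gap inserts the admissible point of least index, so the index of an
  enumerated point that is still strictly inside a gap grows with the level.\<close>

lemma D_between_index: "D m j \<ll> e k \<Longrightarrow> e k \<ll> D m (j + 1) \<Longrightarrow> m \<le> k"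
proof (induction m arbitrary: j k)
  case (Suc m)
  define l r where "l = D m (j div 2)" and "r = D m (j div 2 + 1)"
  define c where "c = mid_index l r"
  have "l \<in> I" "r \<in> I" "l \<ll> r" using D_step by (auto simp: l_def r_def)
  from LeastI_ex[OF prec_dense[OF this]]
  have c: "l \<ll> e c" "e c \<ll> r" by (auto simp: c_def mid_index_def)
  have "m \<le> c" using Suc.IH c by (simp add: l_def r_def)
  have k: "l \<ll> e k \<and> e k \<ll> r \<and> e k \<noteq> e c"
  proof (cases "even j")
    case True
    then have "D (Suc m) j = l" "D (Suc m) (j + 1) = e c"
      by (auto simp: l_def r_def c_def elim!: evenE)
    then show ?thesis using Suc.prems c prec_trans prec_less by (metis less_irrefl)
  next
    case False
    then have "D (Suc m) j = e c" "D (Suc m) (j + 1) = r"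
      by (auto simp: l_def r_def c_def elim!: oddE)
    then show ?thesis using Suc.prems c prec_trans prec_less by (metis less_irrefl)
  qed
  then have "c \<le> k" unfolding c_def mid_index_def by (intro Least_le) simp
  then show ?case using k \<open>m \<le> c\<close> by (cases "c = k") auto
qed simp

text \<open>At level \<open>Suc k\<close> the point \<open>e k\<close> can no longer lie strictly
  inside a gap, so it is equivalent to some \<open>D (Suc k) j\<close>, which inherits its place
  between \<open>x\<close> and \<open>y\<close>.\<close>

lemma D_between:
  assumes "x \<in> I" "y \<in> I" "x \<ll> y"
  obtains m j where "x \<ll> D m j" "D m j \<ll> y"
proof -
  obtain k where k: "x \<ll> e k" "e k \<ll> y" using prec_dense assms by blast
  obtain j where j: "\<not> e k \<ll> D (Suc k) j" "e k \<ll> D (Suc k) (j + 1)"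
    using D_bracket e_I by blast
  have "\<not> D (Suc k) j \<ll> e k" using D_between_index[of "Suc k" j k] j by auto
  then have "x \<ll> D (Suc k) j" "D (Suc k) j \<ll> y"
    using prec_total[OF k(1)] prec_total[OF k(2)] j by blast+
  then show ?thesis using that by blast
qed

section \<open>The collapsing map as a supremum of dyadic labels\<close>

definition h :: "real \<Rightarrow> real" where
  "h x = Sup {real_of_int j / 2 ^ m | j m. \<not> x \<ll> D m j}"

text \<open>Both points reappear at the common level \<open>m + n\<close>, where their order is that
  of the indices.\<close>

lemma D_less_iff: "D m i \<ll> D n j \<longleftrightarrow> real_of_int i / 2 ^ m < real_of_int j / 2 ^ n"
proof -
  have 1: "D m i = D (m + n) (2 ^ n * i)" "D n j = D (m + n) (2 ^ m * j)"
    using D_refine[of m n i] D_refine[of n m j] by (simp_all add: add.commute)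
  have "D m i \<ll> D n j \<longleftrightarrow> 2 ^ n * i < 2 ^ m * j"
    unfolding 1 using D_mono prec_less by (metis linorder_neqE less_asym less_irrefl)
  also have "\<dots> \<longleftrightarrow> real_of_int (2 ^ n * i) < real_of_int (2 ^ m * j)" by linarith
  also have "\<dots> \<longleftrightarrow> real_of_int i / 2 ^ m < real_of_int j / 2 ^ n"
    by (simp add: field_simps)
  finally show ?thesis .
qed

lemma h_bounds:
  assumes "x \<in> I"
  shows "\<not> x \<ll> D m j \<Longrightarrow> real_of_int j / 2 ^ m \<le> h x"
    and "\<not> D m j \<ll> x \<Longrightarrow> h x \<le> real_of_int j / 2 ^ m"
proof -
  define S where "S = {real_of_int j / 2 ^ m | j m. \<not> x \<ll> D m j}"
  have upper: "s \<le> real_of_int j / 2 ^ m" if A: "\<not> D m j \<ll> x" "s \<in> S" for m j s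
  proof -
    obtain i n where i: "s = real_of_int i / 2 ^ n" "\<not> x \<ll> D n i" using A by (auto simp: S_def)
    then have "\<not> D m j \<ll> D n i" using A prec_total by blast
    then show ?thesis using i D_less_iff by simp
  qed
  obtain i where i: "\<not> x \<ll> D 0 i" "x \<ll> D 0 (i + 1)" using D_bracket assms by blast
  have "\<not> D 0 (i + 1) \<ll> x" using i prec_asym by blast
  then have bdd: "bdd_above S" using upper unfolding bdd_above_def by blast
  have ne: "real_of_int i / 2 ^ 0 \<in> S" unfolding S_def using i(1) by blast
  show "real_of_int j / 2 ^ m \<le> h x" if "\<not> x \<ll> D m j"
    unfolding h_def S_def[symmetric] using bdd that by (intro cSup_upper) (auto simp: S_def)
  show "h x \<le> real_of_int j / 2 ^ m" if "\<not> D m j \<ll> x"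
    unfolding h_def S_def[symmetric] using upper[OF that] ne
    by (intro cSup_least) auto
qed

lemma h_less_iff:
  assumes "x \<in> I" "y \<in> I"
  shows "h x < h y \<longleftrightarrow> x \<ll> y"
proof
  assume "x \<ll> y"
  then obtain m i where i: "x \<ll> D m i" "D m i \<ll> y" using D_between assms by blast
  \<comment> \<open>A second dyadic point beyond the first one makes the inequality strict.\<close>
  obtain n j where j: "D m i \<ll> D n j" "D n j \<ll> y" using D_between D_I assms i by blast
  have "h x \<le> real_of_int i / 2 ^ m" using h_bounds(2)[OF assms(1)] i prec_asym by blast
  moreover have "real_of_int j / 2 ^ n \<le> h y" using h_bounds(1)[OF assms(2)] j prec_asym by blast
  ultimately show "h x < h y" using j D_less_iff by fastforce
next
  assume "h x < h y"
  show "x \<ll> y"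
  proof (rule ccontr)
    assume "\<not> x \<ll> y"
    then have "\<not> y \<ll> z \<Longrightarrow> \<not> x \<ll> z" for z using prec_total by blast
    then have "{real_of_int j / 2 ^ m | j m. \<not> y \<ll> D m j} \<subseteq> {real_of_int j / 2 ^ m | j m. \<not> x \<ll> D m j}"
      by blast
    moreover have "bdd_above {real_of_int j / 2 ^ m | j m. \<not> x \<ll> D m j}"
      unfolding bdd_above_def using h_bounds(1)[OF assms(1)] by blast
    moreover obtain i where "\<not> y \<ll> D 0 i" by (rule D_bracket[OF assms(2)])
    then have "{real_of_int j / 2 ^ m | j m. \<not> y \<ll> D m j} \<noteq> {}" by blast
    ultimately have "h y \<le> h x" unfolding h_def by (intro cSup_subset_mono)
    then show False using \<open>h x < h y\<close> by simp
  qed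
qed

lemma h_D: "h (D m j) = real_of_int j / 2 ^ m"
  using h_bounds[OF D_I, of m j m j] prec_less by fastforce

lemma h_mono: "x \<in> I \<Longrightarrow> y \<in> I \<Longrightarrow> x \<le> y \<Longrightarrow> h x \<le> h y"
  using h_less_iff prec_less by (meson not_le)

lemma dyadic_dense: "s < t \<Longrightarrow> \<exists>j m. s < real_of_int j / 2 ^ m \<and> real_of_int j / 2 ^ m < t"
proof -
  assume st: "s < t"
  then obtain m where m: "inverse (2 ^ m) < t - s"
    using real_arch_pow_inv[of "t - s" "1 / 2"] by (auto simp: power_one_over inverse_eq_divide)
  define j where "j = \<lfloor>s * 2 ^ m\<rfloor> + 1"
  have "s * 2 ^ m < real_of_int j" "real_of_int j \<le> s * 2 ^ m + 1" by (auto simp: j_def)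
  then have "s < real_of_int j / 2 ^ m \<and> real_of_int j / 2 ^ m < t"
    using m by (auto simp: field_simps)
  then show ?thesis by blast
qed

lemma h_surj: "h ` I = UNIV"
proof -
  have "t \<in> h ` I" for t
  proof -
    \<comment> \<open>The supremum of the points labelled below \<open>t\<close> is the preimage of
      \<open>t\<close>. Surjectivity later gives the continuity of the monotone map
      \<open>h\<close>.\<close>
    define S where "S = {D m j | m j. real_of_int j / 2 ^ m < t}"
    obtain j m where j: "t - 1 < real_of_int j / 2 ^ m" "real_of_int j / 2 ^ m < t"
      using dyadic_dense[of "t - 1" t] by auto
    obtain i n where i: "t < real_of_int i / 2 ^ n" using dyadic_dense[of t "t + 1"] by auto
    have up: "s \<le> D n i" if A: "s \<in> S" "t \<le> real_of_int i / 2 ^ n" for s n i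
    proof -
      obtain k l where "s = D k l" "real_of_int l / 2 ^ k < t" using A by (auto simp: S_def)
      then show ?thesis using A D_less_iff[of k l n i] prec_less by fastforce
    qed
    have ne: "D m j \<in> S" using j by (auto simp: S_def)
    have bdd: "bdd_above S" using up i by (meson bdd_above.I less_imp_le)
    define x where "x = Sup S"
    have "D m j \<le> x" unfolding x_def using ne bdd by (intro cSup_upper)
    moreover have le: "x \<le> D n i" if "t \<le> real_of_int i / 2 ^ n" for n i
      unfolding x_def using ne up that by (intro cSup_least) auto
    ultimately have x: "x \<in> I" using I D_I i by (meson less_imp_le mem_is_interval_1_I)
    have "\<not> h x < t"
    proof
      assume "h x < t"
      then obtain k l where k: "h x < real_of_int l / 2 ^ k" "real_of_int l / 2 ^ k < t"
        using dyadic_dense by blast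
      then have "D k l \<le> x" unfolding x_def using bdd by (intro cSup_upper) (auto simp: S_def)
      then show False using h_mono[OF D_I x] h_D k by fastforce
    qed
    moreover have "\<not> t < h x"
    proof
      assume "t < h x"
      then obtain k l where k: "t < real_of_int l / 2 ^ k" "real_of_int l / 2 ^ k < h x"
        using dyadic_dense by blast
      then have "h x \<le> h (D k l)" by (intro h_mono[OF x D_I] le) simp
      then show False using h_D k by simp
    qed
    ultimately show ?thesis using x by (intro image_eqI[of _ _ x]) auto
  qed
  then show ?thesis by blast
qed

lemma h_continuous: "continuous_on I h"
  by (rule continuous_onI_mono) (use h_surj h_mono in auto)

end

lemma collapse_map:
  fixes I P :: "real set"
  assumes I: "is_interval I" "open I" "I \<noteq> {}"
    and no_isolated: "\<And>p a b. p \<in> P \<Longrightarrow> a < p \<Longrightarrow> p < b \<Longrightarrow> \<exists>q\<in>P. q \<noteq> p \<and> a < q \<and> q < b"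
    and above: "\<And>x. x \<in> I \<Longrightarrow> \<exists>p\<in>P. x < p \<and> p \<in> I"
    and below: "\<And>x. x \<in> I \<Longrightarrow> \<exists>p\<in>P. p < x \<and> p \<in> I"
  obtains h :: "real \<Rightarrow> real" where "continuous_on I h" "h ` I = UNIV"
    "\<And>x y. x \<in> I \<Longrightarrow> y \<in> I \<Longrightarrow> h x < h y \<longleftrightarrow> (\<exists>p\<in>P. x < p \<and> p < y)"
proof -
  have up: "\<exists>y\<in>I. x < y" and down: "\<exists>y\<in>I. y < x" if "x \<in> I" for x
    using above[OF that] below[OF that] by blast+
  have cnt: "countable (I \<inter> \<rat>)" by (intro countable_Int2 countable_rat)
  have dense: "\<exists>q\<in>I \<inter> \<rat>. a < q \<and> q < b" if "a \<in> I" "b \<in> I" "a < b" for a b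
  proof -
    obtain q where "q \<in> \<rat>" "a < q" "q < b" using Rats_dense_in_real[OF \<open>a < b\<close>] by blast
    then show ?thesis using I(1) that unfolding is_interval_1 by (metis IntI less_imp_le)
  qed
  have "I \<inter> \<rat> \<noteq> {}"
  proof -
    obtain x where "x \<in> I" using I(3) by blast
    then show ?thesis using up[of x] dense[of x] by blast
  qed
  define e where "e = from_nat_into (I \<inter> \<rat>)"
  have e: "range e = I \<inter> \<rat>" unfolding e_def by (rule range_from_nat_into) fact+
  have succ: "\<exists>z\<in>I. \<exists>p\<in>P. max x y < p \<and> p < z" if "x \<in> I" "y \<in> I" for x y
    using above[of "max x y"] that up by (metis max_def)
  have pred: "\<exists>z\<in>I. \<exists>p\<in>P. z < p \<and> p < min x y" if "x \<in> I" "y \<in> I" for x y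
    using below[of "min x y"] that down by (metis min_def)
  \<comment> \<open>Choices beyond both arguments with a point of \<open>P\<close> in between: the
    first argument will be the previous base point, the second an enumerated point to be
    passed.\<close>
  define s where "s x y = (SOME z. z \<in> I \<and> (\<exists>p\<in>P. max x y < p \<and> p < z))" for x y
  define r where "r x y = (SOME z. z \<in> I \<and> (\<exists>p\<in>P. z < p \<and> p < min x y))" for x y
  have s: "s x y \<in> I \<and> (\<exists>p\<in>P. max x y < p \<and> p < s x y)" if "x \<in> I" "y \<in> I" for x y
    unfolding s_def by (rule someI_ex) (use succ that in blast)
  have r: "r x y \<in> I \<and> (\<exists>p\<in>P. r x y < p \<and> p < min x y)" if "x \<in> I" "y \<in> I" for x y
    unfolding r_def by (rule someI_ex) (use pred that in blast)
  have eI: "e k \<in> I" for k using e by blast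
  define U where "U = rec_nat (e 0) (\<lambda>k x. s x (e k))"
  define V where "V = rec_nat (e 0) (\<lambda>k x. r x (e k))"
  have UV: "U 0 = e 0" "V 0 = e 0" "U (Suc k) = s (U k) (e k)" "V (Suc k) = r (V k) (e k)" for k
    by (simp_all add: U_def V_def)
  have UI: "U k \<in> I" and VI: "V k \<in> I" for k by (induction k) (use UV eI s r in auto)
  have U: "e k < U (Suc k)" "\<exists>p\<in>P. U k < p \<and> p < U (Suc k)" for k
    using s[OF UI eI, of k k] UV by force+
  have V: "V (Suc k) < e k" "\<exists>p\<in>P. V (Suc k) < p \<and> p < V k" for k
    using r[OF VI eI, of k k] UV by force+
  \<comment> \<open>\<open>U\<close> runs upwards and \<open>V\<close> downwards from the common
    start \<open>e 0\<close>. They leave every point of \<open>I\<close> behind because step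
    \<open>k\<close> passes \<open>e k\<close>.\<close>
  define base where "base j = (if 0 \<le> j then U (nat j) else V (nat (- j)))" for j :: int
  interpret collapse I P e base
  proof
    show "is_interval I" by fact
    show "\<exists>q\<in>P. q \<noteq> p \<and> a < q \<and> q < b" if "p \<in> P" "a < p" "p < b" for p a b
      using no_isolated that by blast
    show "range e \<subseteq> I" "range base \<subseteq> I" using eI UI VI by (auto simp: base_def)
    show ed: "\<exists>k. a < e k \<and> e k < b" if "a \<in> I" "b \<in> I" "a < b" for a b
      using dense[OF that] e by (metis rangeE)
    show "\<exists>p\<in>P. base j < p \<and> p < base (j + 1)" for j
    proof (cases "0 \<le> j")
      case True
      then show ?thesis using U(2)[of "nat j"] by (simp add: base_def nat_add_distrib)
    next
      case False
      then have "nat (- j) = Suc (nat (- (j + 1)))" by simp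
      then have "base j = V (Suc (nat (- (j + 1))))" "base (j + 1) = V (nat (- (j + 1)))"
        using False UV by (auto simp: base_def)
      then show ?thesis using V(2) by metis
    qed
    show "\<exists>j. x < base j" if x: "x \<in> I" for x
    proof -
      obtain y where "y \<in> I" "x < y" using up x by blast
      then obtain k where "x < e k" using ed x by blast
      then have "x < base (int (Suc k))" using U(1)[of k] by (simp add: base_def nat_add_distrib)
      then show ?thesis by blast
    qed
    show "\<exists>j. base j < x" if x: "x \<in> I" for x
    proof -
      obtain y where "y \<in> I" "y < x" using down x by blast
      then obtain k where "e k < x" using ed x by blast
      then have "base (- int (Suc k)) < x" using V(1)[of k] by (simp add: base_def nat_add_distrib)
      then show ?thesis by blast
    qed
  qed
  show ?thesis
    by (rule that[of h]) (use h_continuous h_surj h_less_iff prec_def in auto)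
qed

section \<open>Groups of homeomorphisms of the line\<close>

lemma homeo_mult [simp]: "f \<otimes>\<^bsub>homeo_plus\<^esub> g = f \<circ> g"
  and homeo_one [simp]: "\<one>\<^bsub>homeo_plus\<^esub> = id"
  by (simp_all add: homeo_plus_def)

text \<open>An increasing surjection of the line has an increasing inverse, and monotone surjections
  are continuous; so membership can be checked by order alone.\<close>

lemma homeo_carrier_iff: "f \<in> carrier homeo_plus \<longleftrightarrow> strict_mono f \<and> surj f"
proof
  assume "strict_mono f \<and> surj f"
  then have f: "strict_mono f" "bij f" by (auto simp: bij_def strict_mono_on_imp_inj_on)
  then obtain g where g: "\<And>x. g (f x) = x" "\<And>x. f (g x) = x"
    by (metis bij_inv_eq_iff)
  have "mono g" using f(1) g by (metis monoI strict_mono_less_eq)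
  moreover have "surj g" using g by (metis surjI)
  ultimately have "continuous_on UNIV g" by (intro continuous_onI_mono) (auto dest: monoD)
  moreover have "continuous_on UNIV f"
    using f by (intro continuous_onI_mono) (auto simp: strict_mono_less_eq bij_def)
  ultimately have "homeomorphism UNIV UNIV f g"
    using g \<open>surj g\<close> f(2) by (auto simp: homeomorphism_def bij_def)
  then show "f \<in> carrier homeo_plus" using f by (auto simp: homeo_plus_def)
next
  assume "f \<in> carrier homeo_plus"
  then show "strict_mono f \<and> surj f" by (auto simp: homeo_plus_def homeomorphism_def)
qed

interpretation HP: group homeo_plus
proof (rule groupI)
  show "f \<otimes>\<^bsub>homeo_plus\<^esub> g \<in> carrier homeo_plus"
    if "f \<in> carrier homeo_plus" "g \<in> carrier homeo_plus" for f g
    using that comp_surj[of g f] by (simp add: homeo_carrier_iff strict_mono_def)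
  show "\<one>\<^bsub>homeo_plus\<^esub> \<in> carrier homeo_plus" by (simp add: homeo_carrier_iff strict_mono_def)
  show "\<exists>g\<in>carrier homeo_plus. g \<otimes>\<^bsub>homeo_plus\<^esub> f = \<one>\<^bsub>homeo_plus\<^esub>"
    if "f \<in> carrier homeo_plus" for f
  proof -
    have f: "strict_mono f" "bij f"
      using that by (auto simp: homeo_carrier_iff bij_def strict_mono_on_imp_inj_on)
    then obtain g where g: "\<And>x. g (f x) = x" "\<And>x. f (g x) = x"
      by (metis bij_inv_eq_iff)
    have "strict_mono g" using f(1) g by (metis strict_monoI strict_mono_less)
    moreover have "surj g" using g by (metis surjI)
    ultimately have "g \<in> carrier homeo_plus" by (simp add: homeo_carrier_iff)
    then show ?thesis using g by (intro bexI[of _ g]) (simp_all add: fun_eq_iff)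
  qed
qed (auto simp: fun_eq_iff)

abbreviation hinv :: "(real \<Rightarrow> real) \<Rightarrow> real \<Rightarrow> real" where
  "hinv f \<equiv> m_inv homeo_plus f"

context
  fixes f assumes f: "f \<in> carrier homeo_plus"
begin

lemma homeo_less_iff [simp]: "f x < f y \<longleftrightarrow> x < y"
  and homeo_le_iff [simp]: "f x \<le> f y \<longleftrightarrow> x \<le> y"
  and homeo_eq_iff [simp]: "f x = f y \<longleftrightarrow> x = y"
  using f by (auto simp: homeo_carrier_iff strict_mono_less strict_mono_less_eq strict_mono_eq)

lemma homeo_inv_simps [simp]: "f (hinv f x) = x" "hinv f (f x) = x"
  using HP.r_inv[OF f] HP.l_inv[OF f] by (auto simp: fun_eq_iff)

lemma homeo_isCont: "isCont f x"
proof -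
  have "continuous_on UNIV f"
    using f by (auto simp: homeo_plus_def homeomorphism_def)
  then show ?thesis by (simp add: continuous_on_eq_continuous_at)
qed

lemma open_supp: "open (supp f)"
proof -
  have "continuous_on UNIV f" by (simp add: continuous_at_imp_continuous_on homeo_isCont)
  then have "closed {x. f x = x}" by (intro closed_Collect_eq) auto
  then show ?thesis by (simp add: supp_def closed_def Compl_eq)
qed

lemma supp_inv: "x \<in> supp f \<longleftrightarrow> f x \<in> supp f"
  by (simp add: supp_def)

end

lemma homeo_shift:
  assumes "f \<in> carrier homeo_plus"
  shows "hinv f x < y \<longleftrightarrow> x < f y" "y < hinv f x \<longleftrightarrow> f y < x"
  using homeo_less_iff[OF assms, of "hinv f x" y] homeo_less_iff[OF assms, of y "hinv f x"] assms
  by simp_all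

lemma disjoint_supports_commute:
  assumes f: "f \<in> carrier homeo_plus" and g: "g \<in> carrier homeo_plus"
    and disj: "\<And>x. f x = x \<or> g x = x"
  shows "f \<circ> g = g \<circ> f"
proof
  fix x
  show "(f \<circ> g) x = (g \<circ> f) x"
  proof (cases "f x = x")
    case True
    show ?thesis
    proof (cases "g x = x")
      case False
      then have "g (g x) \<noteq> g x" using g by simp
      then have "f (g x) = g x" using disj[of "g x"] by blast
      then show ?thesis using True by simp
    qed (use True in simp)
  next
    case False
    then have "f (f x) \<noteq> f x" using f by simp
    then have "g (f x) = f x" using disj[of "f x"] by blast
    moreover have "g x = x" using False disj by blast
    ultimately show ?thesis by simp
  qed
qed

section \<open>Groups of homeomorphisms and their orbit closures\<close>

locale homeo_group =
  fixes G assumes subgroup_G: "subgroup G homeo_plus"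
begin

lemma G_carrier [simp]: "g \<in> G \<Longrightarrow> g \<in> carrier homeo_plus"
  using subgroup_G subgroup.mem_carrier by metis

lemma G_id [simp, intro]: "id \<in> G"
  using subgroup.one_closed[OF subgroup_G] by simp

lemma G_comp [intro]: "g \<in> G \<Longrightarrow> h \<in> G \<Longrightarrow> g \<circ> h \<in> G"
  using subgroup.m_closed[OF subgroup_G] by fastforce

lemma G_inv [intro]: "g \<in> G \<Longrightarrow> hinv g \<in> G"
  using subgroup.m_inv_closed[OF subgroup_G] by fastforce

lemma G_pow: "g \<in> G \<Longrightarrow> g ^^ k \<in> G"
  by (induction k) auto

lemma Supp_inv [simp]: assumes g: "g \<in> G" shows "g x \<in> Supp G \<longleftrightarrow> x \<in> Supp G"
proof -
  have *: "g x \<in> Supp G" if A: "x \<in> Supp G" "g \<in> G" for x g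
  proof -
    obtain h where h: "h \<in> G" "h x \<noteq> x" using A by (auto simp: Supp_def supp_def)
    then have "(g \<circ> h \<circ> hinv g) (g x) \<noteq> g x" using A by simp
    moreover have "g \<circ> h \<circ> hinv g \<in> G" using h A by blast
    ultimately show ?thesis unfolding Supp_def supp_def by blast
  qed
  show ?thesis using *[of x g] *[of "g x" "hinv g"] g by auto
qed

lemma Supp_hinv [simp]: "g \<in> G \<Longrightarrow> hinv g x \<in> Supp G \<longleftrightarrow> x \<in> Supp G"
  using Supp_inv[OF G_inv] .

lemma Supp_fix: "g \<in> G \<Longrightarrow> x \<notin> Supp G \<Longrightarrow> g x = x"
  by (auto simp: Supp_def supp_def)

text \<open>Expresses closure by inequalities, which the increasing elements of \<open>G\<close>
  preserve; the later density arguments use this form.\<close>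

lemma orbit_closure_iff:
  assumes x: "x \<in> Supp G"
  shows "y \<in> orbit_closure G x \<longleftrightarrow>
    y \<in> Supp G \<and> (\<forall>u v. u < y \<longrightarrow> y < v \<longrightarrow> (\<exists>g\<in>G. u < g x \<and> g x < v))"
proof -
  have "orbit G x \<subseteq> Supp G" using x by (auto simp: orbit_def)
  then have oc: "orbit_closure G x = Supp G \<inter> closure (orbit G x)"
    by (simp add: orbit_closure_def closure_of_subtopology Int_absorb1)
  have "y \<in> closure (orbit G x) \<longleftrightarrow> (\<forall>u v. u < y \<longrightarrow> y < v \<longrightarrow> (\<exists>g\<in>G. u < g x \<and> g x < v))"
    (is "?L \<longleftrightarrow> ?R")
  proof
    assume L: ?L
    show ?R
    proof (intro allI impI)
      fix u v :: real assume "u < y" "y < v"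
      then have "{u<..<v} \<inter> orbit G x \<noteq> {}"
        using L open_Int_closure_eq_empty[of "{u<..<v}" "orbit G x"] by auto
      then show "\<exists>g\<in>G. u < g x \<and> g x < v" by (auto simp: orbit_def)
    qed
  next
    assume R: ?R
    show ?L
      unfolding closure_approachable
    proof (intro allI impI)
      fix e :: real assume "0 < e"
      then have "y - e < y" "y < y + e" by auto
      then obtain g where "g \<in> G" "y - e < g x" "g x < y + e" using R by blast
      then show "\<exists>z\<in>orbit G x. dist z y < e" by (auto simp: orbit_def dist_real_def intro!: bexI[of _ "g x"])
    qed
  qed
  then show ?thesis by (simp add: oc)
qed

lemma orbit_closure_invariant:
  assumes "x \<in> Supp G" "g \<in> G" "y \<in> orbit_closure G x"
  shows "g y \<in> orbit_closure G x"
  unfolding orbit_closure_iff[OF assms(1)]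
proof (intro conjI allI impI)
  show "g y \<in> Supp G" using assms(2,3) unfolding orbit_closure_iff[OF assms(1)] by simp
  fix u v assume "u < g y" "g y < v"
  then have "hinv g u < y" "y < hinv g v" using homeo_shift[OF G_carrier[OF assms(2)]] by blast+
  then obtain h where h: "h \<in> G" "hinv g u < h x" "h x < hinv g v"
    using assms(3) unfolding orbit_closure_iff[OF assms(1)] by blast
  then have "u < (g \<circ> h) x" "(g \<circ> h) x < v"
    using homeo_shift[OF G_carrier[OF assms(2)]] by simp_all
  then show "\<exists>g\<in>G. u < g x \<and> g x < v" using h assms by blast
qed

lemma orbit_closure_trans:
  assumes "x \<in> Supp G" "y \<in> orbit_closure G x" "z \<in> orbit_closure G y"
  shows "z \<in> orbit_closure G x"
  unfolding orbit_closure_iff[OF assms(1)]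
proof (intro conjI allI impI)
  have y: "y \<in> Supp G" using assms(2) unfolding orbit_closure_iff[OF assms(1)] by blast
  show "z \<in> Supp G" using assms(3) unfolding orbit_closure_iff[OF y] by blast
  fix u v assume "u < z" "z < v"
  then obtain g where g: "g \<in> G" "u < g y" "g y < v"
    using assms(3) unfolding orbit_closure_iff[OF y] by blast
  have "g y \<in> orbit_closure G x" by (rule orbit_closure_invariant) (use assms g in auto)
  then show "\<exists>g\<in>G. u < g x \<and> g x < v" using g unfolding orbit_closure_iff[OF assms(1)] by blast
qed

lemma subgroup_as_group: "group (as_group G)"
  by (rule subgroup.subgroup_is_group[OF subgroup_G HP.is_group])

lemma as_group_inv [simp]: "g \<in> G \<Longrightarrow> m_inv (as_group G) g = hinv g"
  using subgroup_G by simp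

end

text \<open>Some \<open>x\<close> of \<open>A\<close> lies left of all of \<open>B\<close>, so some
  \<open>z\<close> of \<open>B\<close> outside \<open>A\<close> lies right of all of
  \<open>A\<close>. With a common point \<open>c\<close>, \<open>Inf B\<close> is between
  \<open>x\<close> and \<open>c\<close>, and \<open>Sup A\<close> between \<open>c\<close> and
  \<open>z\<close>. The same points bound \<open>B\<close> below and \<open>A\<close> above.\<close>

lemma overlapping_intervals:
  fixes A B :: "real set"
  assumes A: "open A" "is_interval A" and B: "open B" "is_interval B"
    and AB: "A \<inter> B \<noteq> {}" "A \<inter> B \<subset> B" and le: "left_endpoint A < left_endpoint B"
  shows "Inf B \<in> A" "Sup A \<in> B" "Inf B < Sup A" "\<And>x. x \<in> B \<Longrightarrow> Inf B < x"
    "\<And>x. x \<in> A \<Longrightarrow> x < Sup A" "A \<inter> B = {Inf B<..<Sup A}"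
proof -
  obtain c where c: "c \<in> A" "c \<in> B" using AB by blast
  obtain z where z: "z \<in> B" "z \<notin> A" using AB by blast
  obtain x where x: "x \<in> A" "ereal x < left_endpoint B"
    using le unfolding left_endpoint_def[of A] by (auto simp: Inf_less_iff)
  have xB: "x < y" if "y \<in> B" for y
  proof -
    have "left_endpoint B \<le> ereal y" unfolding left_endpoint_def using that by (intro INF_lower)
    then show ?thesis using x(2) by (metis less_ereal.simps(1) order_less_le_trans)
  qed
  have A_I: "w \<in> A" if "u \<in> A" "v \<in> A" "u \<le> w" "w \<le> v" for u v w
    using A(2) that unfolding is_interval_1 by blast
  have B_I: "w \<in> B" if "u \<in> B" "v \<in> B" "u \<le> w" "w \<le> v" for u v w
    using B(2) that unfolding is_interval_1 by blast
  have bB: "bdd_below B" using xB by (meson bdd_below.I less_imp_le)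
  have InfB: "Inf B \<notin> B"
    using B(1) by (metis Inf_notin_open xB)
  show InfL: "Inf B < y" if "y \<in> B" for y
    using cInf_lower[OF that bB] InfB that by (cases "Inf B = y") auto
  have "x \<le> Inf B" using c xB by (intro cInf_greatest) (auto intro: less_imp_le)
  then show a: "Inf B \<in> A" using A_I[of x c "Inf B"] x c InfL[of c] by simp
  have zc: "c < z" using A_I[of x c z] xB[OF z(1)] x c z(2) by (meson less_imp_le not_le)
  have Az: "y < z" if "y \<in> A" for y using A_I[of c y z] c zc z(2) that by (meson less_imp_le not_le)
  have bA: "bdd_above A" using Az by (meson bdd_above.I less_imp_le)
  have SupA: "Sup A \<notin> A" using A(1) Sup_notin_open Az by metis
  show SupU: "y < Sup A" if "y \<in> A" for y
    using cSup_upper[OF that bA] SupA that by (cases "Sup A = y") auto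
  have "Sup A \<le> z" using c Az by (intro cSup_least) (auto intro: less_imp_le)
  then show b: "Sup A \<in> B" using B_I[of c z "Sup A"] z c SupU[of c] by simp
  show "Inf B < Sup A" using SupU a by blast
  show "A \<inter> B = {Inf B<..<Sup A}"
  proof
    show "{Inf B<..<Sup A} \<subseteq> A \<inter> B"
    proof
      fix y assume y: "y \<in> {Inf B<..<Sup A}"
      then obtain l where "l \<in> B" "l < y" using cInf_lessD[of B y] c by auto
      moreover obtain r where "r \<in> A" "y < r" using y less_cSupD[of A y] c by auto
      ultimately show "y \<in> A \<inter> B" using A_I[of "Inf B" r y] B_I[of l "Sup A" y] y a b by auto
    qed
  qed (use InfL SupU in auto)
qed

text \<open>Otherwise the iterates of \<open>x\<close> have a supremum \<open>s \<le> y\<close>,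
  which lies in the support; then \<open>f\<close> moves an iterate just below \<open>s\<close>
  beyond \<open>s\<close>.\<close>

lemma homeo_bump:
  assumes f: "f \<in> carrier homeo_plus" and J: "is_interval (supp f)" and up: "\<And>t. t \<le> f t"
    and x: "x \<in> supp f" "y \<in> supp f"
  shows "\<exists>k. y < (f ^^ k) x"
proof (rule ccontr)
  assume "\<nexists>k. y < (f ^^ k) x"
  then have le: "(f ^^ k) x \<le> y" for k by (simp add: not_less)
  define X where "X = range (\<lambda>k. (f ^^ k) x)"
  have bdd: "bdd_above X" using le by (auto simp: X_def bdd_above_def)
  define s where "s = Sup X"
  have upper: "(f ^^ k) x \<le> s" for k unfolding s_def using bdd by (intro cSup_upper) (auto simp: X_def)
  have "s \<le> y" unfolding s_def using le by (intro cSup_least) (auto simp: X_def)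
  then have "s \<in> supp f" using upper[of 0] J x unfolding is_interval_1 by fastforce
  then have "s < f s" using up[of s] by (simp add: supp_def less_le)
  then have "hinv f s < s" using homeo_shift f by simp
  then obtain k where "hinv f s < (f ^^ k) x"
    unfolding s_def using less_cSupD[of X] by (auto simp: X_def)
  then have "s < (f ^^ Suc k) x" using homeo_shift f by simp
  then show False using upper[of "Suc k"] by simp
qed

section \<open>Dynamics of chain groups\<close>

text \<open>The isomorphism with \<open>F\<close> is kept out, so that the dynamics apply to pairs
  of consecutive generators, and to the collapsed generators before their pairs are known to
  generate copies of \<open>F\<close>.\<close>

locale chain =
  fixes n :: nat and f :: "nat \<Rightarrow> real \<Rightarrow> real"
  assumes n: "2 \<le> n"
    and f_homeo: "i \<in> {1..n} \<Longrightarrow> f i \<in> carrier homeo_plus"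
    and chain: "chain_of_intervals n (\<lambda>i. supp (f i))"
    and left: "i \<in> {1..<n} \<Longrightarrow> left_endpoint (supp (f i)) < left_endpoint (supp (f (i + 1)))"
    and f_up: "i \<in> {1..n} \<Longrightarrow> t \<le> f i t"
begin

definition G where "G = generate homeo_plus (f ` {1..n})"

abbreviation J where "J i \<equiv> supp (f i)"

abbreviation I where "I \<equiv> Supp G"

text \<open>For \<open>1 \<le> i < n\<close>, \<open>a i\<close> and \<open>b i\<close> are the two
  ends of the overlap of \<open>J i\<close> and \<open>J (i + 1)\<close>; outside this range the
  supports may be unbounded.\<close>

abbreviation a where "a i \<equiv> Inf (J (i + 1))"

abbreviation b where "b i \<equiv> Sup (J i)"

sublocale homeo_group G
  unfolding G_def
  by (rule homeo_group.intro, rule HP.generate_is_subgroup) (use f_homeo in auto)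

lemma f_G: "i \<in> {1..n} \<Longrightarrow> f i \<in> G"
  by (auto simp: G_def intro: generate.incl)

lemma G_induct [consumes 1, case_names id gen inv comp]:
  assumes "g \<in> G" "P id" "\<And>i. i \<in> {1..n} \<Longrightarrow> P (f i)" "\<And>i. i \<in> {1..n} \<Longrightarrow> P (hinv (f i))"
    "\<And>g h. g \<in> G \<Longrightarrow> h \<in> G \<Longrightarrow> P g \<Longrightarrow> P h \<Longrightarrow> P (g \<circ> h)"
  shows "P g"
  using assms(1)[unfolded G_def]
proof (induction rule: generate.induct)
  case (eng g h)
  then have "P (g \<circ> h)" by (intro assms(5)) (simp_all add: G_def)
  then show ?case unfolding homeo_mult .
next
  case one
  show ?case unfolding homeo_one by (rule assms(2))
qed (use assms in auto)

lemma J: "i \<in> {1..n} \<Longrightarrow> J i \<noteq> {}" "i \<in> {1..n} \<Longrightarrow> open (J i)"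
    "i \<in> {1..n} \<Longrightarrow> is_interval (J i)"
  using chain by (auto simp: chain_of_intervals_def)

lemma J_disjoint: "i \<in> {1..n} \<Longrightarrow> k \<in> {1..n} \<Longrightarrow> \<bar>int i - int k\<bar> > 1 \<Longrightarrow> J i \<inter> J k = {}"
  using chain by (auto simp: chain_of_intervals_def)

lemma ab:
  assumes i: "i \<in> {1..<n}"
  shows "a i \<in> J i" "b i \<in> J (i + 1)" "a i < b i" "\<And>x. x \<in> J (i + 1) \<Longrightarrow> a i < x"
    "\<And>x. x \<in> J i \<Longrightarrow> x < b i" "J i \<inter> J (i + 1) = {a i<..<b i}"
proof -
  have 1: "J i \<inter> J (i + 1) \<noteq> {}" "J i \<inter> J (i + 1) \<subset> J (i + 1)"
    using chain i by (auto simp: chain_of_intervals_def)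
  have i': "i \<in> {1..n}" "i + 1 \<in> {1..n}" using i by auto
  note o = overlapping_intervals[OF J(2,3)[OF i'(1)] J(2,3)[OF i'(2)] 1 left[OF i]]
  show "a i \<in> J i" "b i \<in> J (i + 1)" "a i < b i" "\<And>x. x \<in> J (i + 1) \<Longrightarrow> a i < x"
    "\<And>x. x \<in> J i \<Longrightarrow> x < b i" "J i \<inter> J (i + 1) = {a i<..<b i}"
    using o by blast+
qed

lemma I_eq: "I = (\<Union>i\<in>{1..n}. J i)"
proof -
  have "\<forall>x. (\<forall>i\<in>{1..n}. f i x = x) \<longrightarrow> g x = x" if "g \<in> G" for g
    using that
  proof (induction rule: G_induct)
    case (inv i)
    then show ?case using f_homeo homeo_inv_simps by metis
  qed auto
  then show ?thesis using f_G by (fastforce simp: Supp_def supp_def)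
qed

lemma J_I: "i \<in> {1..n} \<Longrightarrow> x \<in> J i \<Longrightarrow> x \<in> I"
  using I_eq by blast

lemma I_open: "open I"
  using I_eq J by auto

lemma J_between: "i \<in> {1..n} \<Longrightarrow> x \<in> J i \<Longrightarrow> y \<in> J i \<Longrightarrow> x \<le> z \<Longrightarrow> z \<le> y \<Longrightarrow> z \<in> J i"
  using J(3) unfolding is_interval_1 by blast

lemma I_interval: "is_interval I"
proof -
  have "connected (\<Union>i\<in>{1..m}. J i)" if "1 \<le> m" "m \<le> n" for m
    using that
  proof (induction m rule: dec_induct)
    case base
    then show ?case using J(3)[of 1] by (simp add: is_interval_connected)
  next
    case (step m)
    have "J m \<inter> J (m + 1) \<noteq> {}"
      using ab(3,6)[of m] step by (metis atLeastLessThan_iff greaterThanLessThan_empty_iff less_eq_Suc_le not_le)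
    then have "(\<Union>i\<in>{1..m}. J i) \<inter> J (Suc m) \<noteq> {}" using step by fastforce
    moreover have "(\<Union>i\<in>{1..Suc m}. J i) = (\<Union>i\<in>{1..m}. J i) \<union> J (Suc m)"
      using step by (auto simp: atLeastAtMostSuc_conv)
    moreover have "connected (J (Suc m))" using step J(3)[of "Suc m"] by (simp add: is_interval_connected)
    moreover have "connected (\<Union>i\<in>{1..m}. J i)" using step by simp
    ultimately show ?case using connected_Un by metis
  qed
  then show ?thesis using n by (simp add: I_eq is_interval_connected_1)
qed

lemma I_between: "x \<in> I \<Longrightarrow> y \<in> I \<Longrightarrow> x \<le> z \<Longrightarrow> z \<le> y \<Longrightarrow> z \<in> I"
  using I_interval unfolding is_interval_1 by blast

lemma pow_J: "i \<in> {1..n} \<Longrightarrow> x \<in> J i \<Longrightarrow> (f i ^^ k) x \<in> J i"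
  by (induction k) (simp_all add: supp_inv[OF f_homeo, symmetric])

section \<open>Moving points along the chain\<close>

lemma move_up:
  assumes i: "i \<in> {1..n}" "x \<in> J i" "y \<in> J i"
  shows "\<exists>g\<in>G. g x \<in> J i \<and> y < g x"
proof -
  obtain k where "y < (f i ^^ k) x" using homeo_bump[OF f_homeo J(3) f_up] i by blast
  then show ?thesis using G_pow f_G pow_J i by blast
qed

lemma move_down:
  assumes i: "i \<in> {1..n}" "x \<in> J i" "y \<in> J i"
  shows "\<exists>g\<in>G. g x \<in> J i \<and> g x < y"
proof -
  obtain k where k: "x < (f i ^^ k) y" using homeo_bump[OF f_homeo J(3) f_up] i by blast
  have g: "f i ^^ k \<in> G" using G_pow f_G i by blast
  have "(f i ^^ k) z = z" if "z \<notin> J i" for z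
    using that by (induction k) (auto simp: supp_def)
  then have "hinv (f i ^^ k) x \<in> J i"
    using i g G_carrier homeo_inv_simps by metis
  then show ?thesis using k g homeo_shift[OF G_carrier[OF g]] by blast
qed

lemma step_up:
  assumes i: "i \<in> {1..<n}" "x \<in> J i"
  shows "\<exists>g\<in>G. g x \<in> J (i + 1)"
proof -
  obtain g where g: "g \<in> G" "g x \<in> J i" "a i < g x" using move_up[of i x "a i"] ab i by auto
  then have "g x \<in> J i \<inter> J (i + 1)" using ab(5)[OF i(1), of "g x"] ab(6)[OF i(1)] by simp
  then show ?thesis using g by blast
qed

lemma step_down:
  assumes i: "i \<in> {1..<n}" "x \<in> J (i + 1)"
  shows "\<exists>g\<in>G. g x \<in> J i"
proof -
  obtain g where g: "g \<in> G" "g x \<in> J (i + 1)" "g x < b i"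
    using move_down[of "i + 1" x "b i"] ab i by auto
  then have "g x \<in> J i \<inter> J (i + 1)" using ab(4)[OF i(1), of "g x"] ab(6)[OF i(1)] by simp
  then show ?thesis using g by blast
qed

text \<open>A point is passed through the overlaps down to \<open>J 1\<close> and from there up to
  \<open>J j\<close>.\<close>

lemma reach:
  assumes x: "x \<in> I" and j: "j \<in> {1..n}"
  shows "\<exists>g\<in>G. g x \<in> J j"
proof -
  have 1: "x \<in> J i \<longrightarrow> (\<exists>g\<in>G. g x \<in> J 1)" if "1 \<le> i" "i \<le> n" for i x
    using that
  proof (induction i arbitrary: x rule: dec_induct)
    case base
    show ?case using G_id by (metis id_apply)
  next
    case (step m)
    show ?case
    proof
      assume "x \<in> J (Suc m)"
      then obtain g where g: "g \<in> G" "g x \<in> J m" using step_down[of m x] step by auto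
      then obtain h where "h \<in> G" "h (g x) \<in> J 1" using step by auto
      then show "\<exists>g\<in>G. g x \<in> J 1" using g by (metis G_comp comp_apply)
    qed
  qed
  have 2: "\<exists>g\<in>G. g x \<in> J i" if "1 \<le> i" "i \<le> n" "x \<in> J 1" for i x
    using that
  proof (induction i rule: dec_induct)
    case base
    then show ?case using G_id by (metis id_apply)
  next
    case (step m)
    then obtain g where g: "g \<in> G" "g x \<in> J m" by auto
    then obtain h where "h \<in> G" "h (g x) \<in> J (Suc m)" using step_up[of m "g x"] step by auto
    then show ?case using g by (metis G_comp comp_apply)
  qed
  obtain i where "i \<in> {1..n}" "x \<in> J i" using x I_eq by auto
  then obtain g where g: "g \<in> G" "g x \<in> J 1" using 1[of i x] by auto
  then obtain h where "h \<in> G" "h (g x) \<in> J j" using 2[of j "g x"] j by auto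
  then show ?thesis using g by (metis G_comp comp_apply)
qed

lemma reach_above: assumes "x \<in> I" "y \<in> I" shows "\<exists>g\<in>G. y < g x"
proof -
  obtain j where j: "j \<in> {1..n}" "y \<in> J j" using assms I_eq by auto
  obtain g where g: "g \<in> G" "g x \<in> J j" using reach assms j by blast
  obtain h where "h \<in> G" "y < h (g x)" using move_up j g by blast
  then show ?thesis using g by (metis G_comp comp_apply)
qed

lemma reach_below: assumes "x \<in> I" "y \<in> I" shows "\<exists>g\<in>G. g x < y"
proof -
  obtain g where g: "g \<in> G" "x < g y" using reach_above assms by blast
  then have "hinv g x < y" using homeo_shift G_carrier by metis
  then show ?thesis using g by blast
qed

lemma one_less_n: "1 \<in> {1..<n}" "1 \<in> {1..n}" "2 \<in> {1..n}" "n - 1 \<in> {1..<n}" "n \<in> {1..n}"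
  using n by auto

lemma beta_I: "b 1 \<in> I"
  using ab(2)[OF one_less_n(1)] J_I[OF one_less_n(3)] by (simp add: numeral_2_eq_2)

lemma J_near_b:
  assumes "i \<in> {1..<n}" "u < b i"
  shows "\<exists>y\<in>J i. u < y"
proof -
  have "J i \<noteq> {}" using J assms by auto
  then show ?thesis using less_cSupD assms(2) by blast
qed

text \<open>\<open>f 1\<close> pushes the points of \<open>J 1\<close> towards \<open>b 1\<close>,
  which they never reach. That the approach is strictly from the left excludes isolated points in
  the orbit closure of \<open>b 1\<close>.\<close>

lemma beta_approx:
  assumes x: "x \<in> I" and u: "u < b 1"
  shows "\<exists>g\<in>G. u < g x \<and> g x < b 1"
proof -
  obtain y where y: "y \<in> J 1" "u < y" using J_near_b[OF one_less_n(1) u] by blast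
  obtain g where g: "g \<in> G" "g x \<in> J 1" using reach x one_less_n by blast
  obtain h where h: "h \<in> G" "h (g x) \<in> J 1" "y < h (g x)" using move_up[OF one_less_n(2)] g y by blast
  then have "u < (h \<circ> g) x \<and> (h \<circ> g) x < b 1" using y ab(5)[OF one_less_n(1)] by force
  then show ?thesis using g h by blast
qed

lemma beta_minimal:
  assumes x: "x \<in> I"
  shows "b 1 \<in> orbit_closure G x"
  unfolding orbit_closure_iff[OF x]
proof (intro conjI beta_I allI impI)
  fix u v assume "u < b 1" "b 1 < v"
  then show "\<exists>g\<in>G. u < g x \<and> g x < v" using beta_approx[OF x, of u] less_trans by blast
qed

text \<open>With \<open>less_b\<close>: left of \<open>a 1\<close> only \<open>f 1\<close> moves
  points, and right of \<open>b (n - 1)\<close> only \<open>f n\<close> does.\<close>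

lemma a_less: "j \<in> {2..n} \<Longrightarrow> x \<in> J j \<Longrightarrow> a 1 < x"
proof -
  have *: "a 1 \<le> a i" if "1 \<le> i" "i < n" for i
    using that
  proof (induction i rule: dec_induct)
    case (step m)
    then have "a (Suc m) \<in> J (m + 1)" using ab(1)[of "Suc m"] by simp
    then have "a m < a (Suc m)" by (rule ab(4)[rotated]) (use step in simp)
    then show ?case using step by simp
  qed simp
  then show "a 1 < x" if j: "j \<in> {2..n}" "x \<in> J j"
  proof -
    obtain i where i: "j = i + 1" "i \<in> {1..<n}" using j(1) by (intro that[of "j - 1"]) auto
    then have "a i < x" using ab(4) j(2) by blast
    moreover have "a 1 \<le> a i" using i * by simp
    ultimately show ?thesis by linarith
  qed
qed

lemma less_b: "j \<in> {1..<n} \<Longrightarrow> x \<in> J j \<Longrightarrow> x < b (n - 1)"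
proof -
  have *: "b i \<le> b j" if "i \<le> j" "1 \<le> i" "j < n" for i j
    using that
  proof (induction j rule: dec_induct)
    case (step m)
    then have "b m < b (Suc m)" using ab(2)[of m] ab(5)[of "Suc m" "b m"] by simp
    then show ?case using step by simp
  qed simp
  then show "x < b (n - 1)" if j: "j \<in> {1..<n}" "x \<in> J j"
  proof -
    have "x < b j" using j ab(5) by blast
    moreover have "b j \<le> b (n - 1)" using j n by (intro *) auto
    ultimately show ?thesis by linarith
  qed
qed

text \<open>Lets a whole compact interval be brought into \<open>J 1\<close> by moving only its
  right end there.\<close>

lemma J1_below: "x \<in> I \<Longrightarrow> y \<in> J 1 \<Longrightarrow> x \<le> y \<Longrightarrow> x \<in> J 1"
proof -
  assume x: "x \<in> I" "y \<in> J 1" "x \<le> y"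
  then obtain j where j: "j \<in> {1..n}" "x \<in> J j" using I_eq by auto
  show "x \<in> J 1"
  proof (cases "j = 1")
    case False
    then have "a 1 < x" using a_less[of j x] j by auto
    then have "a 1 \<le> x" by linarith
    then show ?thesis by (rule J_between[OF one_less_n(2) ab(1)[OF one_less_n(1)] x(2) _ x(3)])
  qed (use j in simp)
qed

lemma beta_self: "b 1 \<in> orbit_closure G (b 1)"
  by (rule beta_minimal[OF beta_I])

lemma orbit_closure_I: "x \<in> I \<Longrightarrow> y \<in> orbit_closure G x \<Longrightarrow> y \<in> I"
  by (simp add: orbit_closure_iff)

lemma acts_minimally_iff: "acts_minimally G \<longleftrightarrow> I \<subseteq> orbit_closure G (b 1)"
proof
  assume "acts_minimally G"
  then show "I \<subseteq> orbit_closure G (b 1)" using beta_I by (auto simp: acts_minimally_def)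
next
  assume *: "I \<subseteq> orbit_closure G (b 1)"
  have "orbit_closure G x = I" if x: "x \<in> I" for x
    using orbit_closure_I[OF x] orbit_closure_trans[OF x beta_minimal[OF x]] * by blast
  then show "acts_minimally G" by (simp add: acts_minimally_def)
qed

text \<open>Near \<open>p\<close> there is some \<open>g (b 1)\<close>, and by
  \<open>beta_approx\<close> a second orbit point just left of it; at most one of the two equals
  \<open>p\<close>.\<close>

lemma beta_orbit_closure_no_isolated:
  assumes p: "p \<in> orbit_closure G (b 1)" and uv: "u < p" "p < v"
  shows "\<exists>q\<in>orbit_closure G (b 1). q \<noteq> p \<and> u < q \<and> q < v"
proof -
  obtain g where g: "g \<in> G" "u < g (b 1)" "g (b 1) < v"
    using p uv unfolding orbit_closure_iff[OF beta_I] by blast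
  then have "hinv g u < b 1" using homeo_shift[OF G_carrier] by blast
  then obtain h where h: "h \<in> G" "hinv g u < h (b 1)" "h (b 1) < b 1"
    using beta_approx[OF beta_I] by blast
  have lt: "u < g (h (b 1))" "g (h (b 1)) < g (b 1)"
    using h homeo_shift[OF G_carrier[OF g(1)]] homeo_less_iff[OF G_carrier[OF g(1)]] by blast+
  have "g (b 1) \<in> orbit_closure G (b 1)" "g (h (b 1)) \<in> orbit_closure G (b 1)"
    using g h orbit_closure_invariant[OF beta_I] beta_self by blast+
  moreover have "g (b 1) \<noteq> p \<or> g (h (b 1)) \<noteq> p" using lt by auto
  moreover have "g (h (b 1)) < v" using lt g by linarith
  ultimately show ?thesis using g lt by blast
qed

text \<open>Every orbit comes near \<open>b 1\<close> and is then carried by \<open>g\<close> into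
  the interval. As the orbit closure of \<open>b 1\<close> is invariant, it contains
  \<open>z\<close> along with \<open>g (h z)\<close>.\<close>

lemma interval_in_orbit_closure_minimal:
  assumes xy: "x < y" and sub: "{x<..<y} \<subseteq> orbit_closure G (b 1)"
  shows "acts_minimally G"
  unfolding acts_minimally_iff
proof
  fix z assume z: "z \<in> I"
  obtain m where m: "x < m" "m < y" using dense xy by blast
  then have "m \<in> orbit_closure G (b 1)" using sub by auto
  then obtain g where g: "g \<in> G" "x < g (b 1)" "g (b 1) < y"
    using m unfolding orbit_closure_iff[OF beta_I] by blast
  then have "hinv g x < b 1" "b 1 < hinv g y" using homeo_shift[OF G_carrier] by blast+
  then obtain h where h: "h \<in> G" "hinv g x < h z" "h z < hinv g y"
    using beta_minimal[OF z] unfolding orbit_closure_iff[OF z] by blast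
  then have "g (h z) \<in> orbit_closure G (b 1)"
    using sub homeo_shift[OF G_carrier[OF g(1)]] by auto
  then have "hinv h (hinv g (g (h z))) \<in> orbit_closure G (b 1)"
    by (rule orbit_closure_invariant[OF beta_I G_inv[OF h(1)]
          orbit_closure_invariant[OF beta_I G_inv[OF g(1)]]])
  then show "z \<in> orbit_closure G (b 1)" using g h by simp
qed

lemma Cantor_orbit_beta:
  assumes "\<not> acts_minimally G"
  shows "Cantor_orbit G (b 1)"
  unfolding Cantor_orbit_def
proof
  define \<Lambda> where "\<Lambda> = orbit_closure G (b 1)"
  have \<Lambda>I: "\<Lambda> \<subseteq> I" using orbit_closure_I[OF beta_I] by (auto simp: \<Lambda>_def)
  have "y \<in> \<Lambda>" if y: "y \<in> I" "\<forall>T. y \<in> T \<and> open T \<longrightarrow> (\<exists>q. q \<noteq> y \<and> q \<in> \<Lambda> \<and> q \<in> T)" for y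
    unfolding \<Lambda>_def orbit_closure_iff[OF beta_I]
  proof (intro conjI y(1) allI impI)
    fix u v assume uv: "u < y" "y < v"
    then obtain q where "q \<in> \<Lambda>" "u < q" "q < v" using y(2)[rule_format, of "{u<..<v}"] by auto
    then show "\<exists>g\<in>G. u < g (b 1) \<and> g (b 1) < v"
      unfolding \<Lambda>_def orbit_closure_iff[OF beta_I] by blast
  qed
  moreover have "\<exists>q. q \<noteq> y \<and> q \<in> \<Lambda> \<and> q \<in> T" if y: "y \<in> \<Lambda>" "y \<in> T" "open T" for y T
  proof -
    obtain e where e: "0 < e" "ball y e \<subseteq> T" using y open_contains_ball by blast
    obtain q where "q \<in> \<Lambda>" "q \<noteq> y" "y - e < q" "q < y + e"
      using beta_orbit_closure_no_isolated[of y "y - e" "y + e"] y e by (auto simp: \<Lambda>_def)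
    then show ?thesis using e by (intro exI[of _ q]) (auto simp: dist_real_def subset_iff)
  qed
  ultimately show "perfect_in (top_of_set I) (orbit_closure G (b 1))"
    using \<Lambda>I unfolding perfect_in_def \<Lambda>_def[symmetric] derived_set_of_subtopology
    by (auto simp: in_derived_set_of Int_absorb1)
  show "totally_disconnected (orbit_closure G (b 1))"
    unfolding totally_disconnected_def
  proof (intro allI impI ballI)
    fix T x y assume T: "T \<subseteq> orbit_closure G (b 1) \<and> connected T" "x \<in> T" "y \<in> T"
    have False if "x < y" "x \<in> T" "y \<in> T" for x y
    proof -
      have "{x..y} \<subseteq> T" using T that by (simp add: connected_contains_Icc)
      then have "{x<..<y} \<subseteq> orbit_closure G (b 1)" using T by (auto simp: subset_iff)
      then show False using assms interval_in_orbit_closure_minimal that by blast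
    qed
    then show "x = y" using T by (metis linorder_neqE)
  qed
qed

lemma minimal_no_Cantor:
  assumes "acts_minimally G" "x \<in> I"
  shows "\<not> Cantor_orbit G x"
proof
  assume "Cantor_orbit G x"
  then have td: "totally_disconnected I"
    using assms by (simp add: Cantor_orbit_def acts_minimally_def)
  have "connected I" using I_interval is_interval_connected by blast
  moreover obtain g where "g \<in> G" "g x < x" using reach_below[OF assms(2,2)] by blast
  moreover from this have "g x \<in> I" using assms(2) by simp
  ultimately show False
    using td[unfolded totally_disconnected_def, rule_format, of I x "g x"] assms(2) by simp
qed

section \<open>The commutator subgroup: compact supports and noncommuting elements\<close>

definition D where "D = derived homeo_plus G"

lemma D_eq: "derived (as_group G) G = D"
  unfolding D_def by (rule HP.derived_consistent) (use subgroup_G in auto)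

lemma D_G: "D \<subseteq> G"
  unfolding D_def by (rule HP.derived_incl) (use subgroup_G in auto)

lemma D_subgroup: "subgroup D homeo_plus"
  unfolding D_def by (rule HP.derived_is_subgroup) auto

sublocale D: homeo_group D
  by (rule homeo_group.intro[OF D_subgroup])

lemma D_normal: "D \<lhd> as_group G"
proof -
  interpret K: group "as_group G" by (rule subgroup_as_group)
  show ?thesis using K.derived_is_normal[OF K.normal_self] by (simp add: D_eq)
qed

lemma commutator_D: "g \<in> G \<Longrightarrow> h \<in> G \<Longrightarrow> g \<circ> h \<circ> hinv g \<circ> hinv h \<in> D"
  unfolding D_def derived_def by (rule generate.incl) fastforce

lemma D_conj: "g \<in> G \<Longrightarrow> d \<in> D \<Longrightarrow> g \<circ> d \<circ> hinv g \<in> D"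
  using normal.inv_op_closed2[OF D_normal, of g d] by simp

text \<open>\<open>E P\<close> stands for \<open>P\<close> holding near one end of \<open>I\<close>.
  The germs of the generators at that end commute, so all germs of \<open>G\<close> commute and
  commutators have trivial germ. One proof serves both ends.\<close>

lemma derived_germ_trivial:
  fixes E :: "(real \<Rightarrow> bool) \<Rightarrow> bool"
  assumes mono: "\<And>P Q. E P \<Longrightarrow> (\<And>x. P x \<Longrightarrow> Q x) \<Longrightarrow> E Q"
    and conj: "\<And>P Q. E P \<Longrightarrow> E Q \<Longrightarrow> E (\<lambda>x. P x \<and> Q x)"
    and shift: "\<And>g P. g \<in> G \<Longrightarrow> E P \<Longrightarrow> E (\<lambda>x. P (g x))"
    and gen: "\<And>i j. i \<in> {1..n} \<Longrightarrow> j \<in> {1..n} \<Longrightarrow> E (\<lambda>x. f i (f j x) = f j (f i x))"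
    and d: "d \<in> D"
  shows "E (\<lambda>x. d x = x)"
proof -
  have ET: "E (\<lambda>x. True)" by (rule mono[OF gen[OF one_less_n(2,2)]]) simp
  have step: "E (\<lambda>x. k (g x) = g (k x))"
    if k: "\<And>i. i \<in> {1..n} \<Longrightarrow> E (\<lambda>x. k (f i x) = f i (k x))" and g: "g \<in> G" for k g
    using g
  proof (induction rule: G_induct)
    case id
    show ?case using ET by simp
  next
    case (gen i)
    then show ?case by (rule k)
  next
    case (inv i)
    have "E (\<lambda>x. k (f i (hinv (f i) x)) = f i (k (hinv (f i) x)))"
      by (rule shift[OF _ k[OF inv]]) (use f_G inv in blast)
    then show ?case by (rule mono) (use f_homeo[OF inv] homeo_inv_simps in metis)
  next
    case (comp g h)
    have "E (\<lambda>x. k (g (h x)) = g (k (h x)))" by (rule shift[OF comp(2,3)])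
    from conj[OF this comp(4)] show ?case by (rule mono) simp
  qed
  have "E (\<lambda>x. f i (h x) = h (f i x))" if "h \<in> G" "i \<in> {1..n}" for i h
    using step[of "f i" h] gen that by simp
  then have "E (\<lambda>x. h (f i x) = f i (h x))" if "h \<in> G" "i \<in> {1..n}" for i h
    by (rule mono) (use that in auto)
  then have gh: "E (\<lambda>x. g (h x) = h (g x))" if "g \<in> G" "h \<in> G" for g h
    using step that by blast
  show ?thesis using d unfolding D_def derived_def
  proof (induction rule: generate.induct)
    case one
    show ?case using ET by simp
  next
    case (incl d)
    then obtain g h where d: "g \<in> G" "h \<in> G" "d = g \<circ> h \<circ> hinv g \<circ> hinv h" by auto
    have "E (\<lambda>x. g (h ((hinv g \<circ> hinv h) x)) = h (g ((hinv g \<circ> hinv h) x)))"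
      by (rule shift[OF _ gh]) (use d in blast)+
    then show ?case by (rule mono) (use d in simp)
  next
    case (inv d)
    then obtain g h where d: "g \<in> G" "h \<in> G" "d = g \<circ> h \<circ> hinv g \<circ> hinv h" by auto
    then have dG: "d \<in> G" using commutator_D D_G by blast
    have "E (\<lambda>x. g (h ((hinv g \<circ> hinv h) x)) = h (g ((hinv g \<circ> hinv h) x)))"
      by (rule shift[OF _ gh]) (use d in blast)+
    then have "E (\<lambda>x. d x = x)" by (rule mono) (use d in simp)
    then show ?case by (rule mono) (use dG G_carrier homeo_inv_simps in metis)
  next
    case (eng g h)
    from conj[OF eng(3,4)] show ?case by (rule mono) simp
  qed
qed

lemma derived_trivial_left:
  assumes "d \<in> D"
  shows "\<exists>p\<in>I. \<forall>x\<in>I. x < p \<longrightarrow> d x = x"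
proof (rule derived_germ_trivial[OF _ _ _ _ assms, of "\<lambda>P. \<exists>p\<in>I. \<forall>x\<in>I. x < p \<longrightarrow> P x"])
  show "\<exists>p\<in>I. \<forall>x\<in>I. x < p \<longrightarrow> P x \<and> Q x"
    if A: "\<exists>p\<in>I. \<forall>x\<in>I. x < p \<longrightarrow> P x" "\<exists>p\<in>I. \<forall>x\<in>I. x < p \<longrightarrow> Q x" for P Q
  proof -
    obtain p q where "p \<in> I" "q \<in> I" "\<forall>x\<in>I. x < p \<longrightarrow> P x" "\<forall>x\<in>I. x < q \<longrightarrow> Q x"
      using A by blast
    then show ?thesis by (intro bexI[of _ "min p q"]) (auto simp: min_def)
  qed
  show "\<exists>p\<in>I. \<forall>x\<in>I. x < p \<longrightarrow> P (g x)"
    if A: "g \<in> G" "\<exists>p\<in>I. \<forall>x\<in>I. x < p \<longrightarrow> P x" for g P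
  proof -
    obtain p where "p \<in> I" "\<forall>x\<in>I. x < p \<longrightarrow> P x" using A by blast
    then show ?thesis using A homeo_shift[OF G_carrier[OF A(1)]]
      by (intro bexI[of _ "hinv g p"]) auto
  qed
  show "\<exists>p\<in>I. \<forall>x\<in>I. x < p \<longrightarrow> f i (f j x) = f j (f i x)" if ij: "i \<in> {1..n}" "j \<in> {1..n}" for i j
  proof (intro bexI ballI impI)
    have f1: "f 1 \<in> G" by (rule f_G[OF one_less_n(2)])
    \<comment> \<open>Below this point not only \<open>x\<close> but also \<open>f 1 x\<close> lies
      left of \<open>a 1\<close>, where only \<open>f 1\<close> moves points.\<close>
    show "hinv (f 1) (a 1) \<in> I"
      using Supp_inv[OF G_inv[OF f1]] J_I[OF one_less_n(2) ab(1)[OF one_less_n(1)]] by blast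
    fix x assume "x < hinv (f 1) (a 1)"
    then have 1: "f 1 x < a 1" using homeo_shift[OF G_carrier[OF f1]] by blast
    then have 2: "x < a 1" using f_up[OF one_less_n(2), of x] by linarith
    have "f k y = y" if "k \<in> {1..n}" "k \<noteq> 1" "y < a 1" for k y
      using a_less[of k y] that by (fastforce simp: supp_def)
    then show "f i (f j x) = f j (f i x)" using ij 1 2 by metis
  qed
qed blast

lemma derived_trivial_right:
  assumes "d \<in> D"
  shows "\<exists>p\<in>I. \<forall>x\<in>I. p < x \<longrightarrow> d x = x"
proof (rule derived_germ_trivial[OF _ _ _ _ assms, of "\<lambda>P. \<exists>p\<in>I. \<forall>x\<in>I. p < x \<longrightarrow> P x"])
  show "\<exists>p\<in>I. \<forall>x\<in>I. p < x \<longrightarrow> P x \<and> Q x"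
    if A: "\<exists>p\<in>I. \<forall>x\<in>I. p < x \<longrightarrow> P x" "\<exists>p\<in>I. \<forall>x\<in>I. p < x \<longrightarrow> Q x" for P Q
  proof -
    obtain p q where "p \<in> I" "q \<in> I" "\<forall>x\<in>I. p < x \<longrightarrow> P x" "\<forall>x\<in>I. q < x \<longrightarrow> Q x"
      using A by blast
    then show ?thesis by (intro bexI[of _ "max p q"]) (auto simp: max_def)
  qed
  show "\<exists>p\<in>I. \<forall>x\<in>I. p < x \<longrightarrow> P (g x)"
    if A: "g \<in> G" "\<exists>p\<in>I. \<forall>x\<in>I. p < x \<longrightarrow> P x" for g P
  proof -
    obtain p where "p \<in> I" "\<forall>x\<in>I. p < x \<longrightarrow> P x" using A by blast
    then show ?thesis using A homeo_shift[OF G_carrier[OF A(1)]]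
      by (intro bexI[of _ "hinv g p"]) auto
  qed
  show "\<exists>p\<in>I. \<forall>x\<in>I. p < x \<longrightarrow> f i (f j x) = f j (f i x)" if ij: "i \<in> {1..n}" "j \<in> {1..n}" for i j
  proof (intro bexI ballI impI)
    \<comment> \<open>Here the endpoint itself suffices, because \<open>f n\<close> moves points up
      and so keeps them right of \<open>b (n - 1)\<close>.\<close>
    show "b (n - 1) \<in> I" using J_I[OF one_less_n(5)] ab(2)[OF one_less_n(4)] n by simp
    fix x assume 1: "b (n - 1) < x"
    then have 2: "b (n - 1) < f n x" using f_up[OF one_less_n(5), of x] by linarith
    have "f k y = y" if "k \<in> {1..n}" "k \<noteq> n" "b (n - 1) < y" for k y
      using less_b[of k y] that by (fastforce simp: supp_def)
    then show "f i (f j x) = f j (f i x)" using ij 1 2 by metis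
  qed
qed blast

lemma derived_compact_support:
  assumes "d \<in> D"
  obtains p q where "p \<in> I" "q \<in> I" "p < q" "\<And>x. x < p \<or> q < x \<Longrightarrow> d x = x"
proof -
  obtain p where p: "p \<in> I" "\<And>x. x \<in> I \<Longrightarrow> x < p \<Longrightarrow> d x = x"
    using derived_trivial_left[OF assms] by metis
  obtain q where q: "q \<in> I" "\<And>x. x \<in> I \<Longrightarrow> q < x \<Longrightarrow> d x = x"
    using derived_trivial_right[OF assms] by metis
  have a: "a 1 \<in> I" "a 1 < b 1" using ab(1,3)[OF one_less_n(1)] J_I[OF one_less_n(2)] by blast+
  have fixd: "d x = x" if "x \<notin> I" for x using Supp_fix D_G assms that by blast
  show ?thesis
  proof (rule that)
    \<comment> \<open>\<open>a 1 < b 1\<close> are included to guarantee that the interval is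
      nondegenerate.\<close>
    show "min p (a 1) \<in> I" "max q (b 1) \<in> I" "min p (a 1) < max q (b 1)"
      using p q a beta_I by (auto simp: min_def max_def)
    show "d x = x" if "x < min p (a 1) \<or> max q (b 1) < x" for x
      using p(2)[of x] q(2)[of x] fixd[of x] that by auto
  qed
qed

text \<open>The commutator \<open>c\<close> of \<open>f 2\<close> and \<open>f 1\<close> moves
  \<open>b 1\<close> up. A conjugate \<open>d\<close> of \<open>c\<close> has the supremum
  \<open>t\<close> of its support just below \<open>b 1\<close>, where \<open>c\<close> still moves
  points up. Some \<open>x\<close> moved by \<open>d\<close> is carried by \<open>c\<close> beyond
  \<open>t\<close>, where \<open>d\<close> is trivial; so
  \<open>c (d x) \<noteq> c x = d (c x)\<close>.\<close>

lemma derived_nonabelian: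
  obtains c d where "c \<in> D" "d \<in> D" "c \<circ> d \<noteq> d \<circ> c"
proof -
  have f1: "f 1 \<in> G" and f2: "f 2 \<in> G" using f_G one_less_n by blast+
  note c1 = G_carrier[OF f1] and c2 = G_carrier[OF f2]
  define c where "c = f 2 \<circ> f 1 \<circ> hinv (f 2) \<circ> hinv (f 1)"
  have cD: "c \<in> D" unfolding c_def by (rule commutator_D[OF f2 f1])
  then have cG: "c \<in> G" using D_G by blast
  have b2: "b 1 \<in> J 2" using ab(2)[OF one_less_n(1)] by (simp add: numeral_2_eq_2)
  have "b 1 \<notin> J 1" using ab(5)[OF one_less_n(1), of "b 1"] by blast
  then have fb: "f 1 (b 1) = b 1" by (simp add: supp_def)
  then have fb': "hinv (f 1) (b 1) = b 1" using homeo_inv_simps(2)[OF c1] by metis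
  \<comment> \<open>\<open>f 1\<close> fixes \<open>b 1\<close>, so \<open>c\<close> sends
    \<open>b 1\<close> to \<open>f 2 (f 1 y)\<close>. This is above \<open>f 2 y = b 1\<close> once
    \<open>y\<close> is shown to lie in the overlap.\<close>
  define y where "y = hinv (f 2) (b 1)"
  have f2y: "f 2 y = b 1" using c2 by (simp add: y_def)
  then have y2: "y \<in> J 2" using supp_inv[OF c2, of y] b2 by simp
  then have "y \<noteq> f 2 y" by (auto simp: supp_def)
  then have yb: "y < b 1" using f_up[OF one_less_n(3), of y] f2y by simp
  have "a 1 < y" using ab(4)[OF one_less_n(1)] y2 by (simp add: numeral_2_eq_2)
  then have "y \<in> {a 1<..<b 1}" using yb by simp
  then have "y \<in> J 1" using ab(6)[OF one_less_n(1)] by blast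
  then have "y < f 1 y" using f_up[OF one_less_n(2), of y] by (simp add: supp_def less_le)
  then have "f 2 y < f 2 (f 1 y)" using c2 by simp
  then have cb: "b 1 < c (b 1)" using fb' f2y by (simp add: c_def y_def)
  obtain p q where pq: "p \<in> I" "q \<in> I" "\<And>x. x < p \<or> q < x \<Longrightarrow> c x = x"
    using derived_compact_support[OF cD] by metis
  define s where "s = Sup (supp c)"
  have bdd: "bdd_above (supp c)" using pq(3) by (intro bdd_aboveI[of _ q]) (force simp: supp_def)
  have bs: "b 1 \<in> supp c" using cb by (simp add: supp_def)
  have upper: "x \<le> s" if "x \<in> supp c" for x
    unfolding s_def using that bdd by (rule cSup_upper)
  have "s \<le> q" unfolding s_def
    using bs pq(3) by (intro cSup_least) (force simp: supp_def)+
  then have sI: "s \<in> I" using I_between[OF beta_I pq(2)] upper[OF bs] by blast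
  have "isCont (\<lambda>x. c x - x) (b 1)"
    by (intro continuous_intros homeo_isCont[OF G_carrier[OF cG]])
  then have "\<forall>\<^sub>F x in at (b 1). 0 < c x - x"
    using cb by (intro order_tendstoD(1)) (auto simp: isCont_def)
  then obtain e where e: "0 < e" "\<And>x. x \<noteq> b 1 \<Longrightarrow> dist x (b 1) < e \<Longrightarrow> x < c x"
    unfolding eventually_at by force
  obtain k where k: "k \<in> G" "b 1 - e < k s" "k s < b 1" using beta_approx[OF sI, of "b 1 - e"] e by auto
  define t where "t = k s"
  have ct: "t < c t" using e(2)[of t] k by (simp add: t_def dist_real_def)
  define d where "d = k \<circ> c \<circ> hinv k"
  have dD: "d \<in> D" unfolding d_def by (rule D_conj[OF k(1) cD])
  have above: "d x = x" if "t < x" for x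
  proof -
    have "s < hinv k x" using homeo_shift[OF G_carrier[OF k(1)]] that by (simp add: t_def)
    then have "c (hinv k x) = hinv k x" using upper by (fastforce simp: supp_def)
    then show ?thesis using k by (simp add: d_def)
  qed
  have "hinv c t < t" using homeo_shift[OF G_carrier[OF cG]] ct by simp
  then have "hinv k (hinv c t) < s" using homeo_shift[OF G_carrier[OF k(1)]] by (simp add: t_def)
  \<comment> \<open>As \<open>s\<close> is the supremum of \<open>supp c\<close>, some point
    \<open>k w\<close> moved by \<open>d\<close> lies beyond \<open>hinv c t\<close>.\<close>
  then obtain w where w: "w \<in> supp c" "hinv k (hinv c t) < w"
    using less_cSupD[of "supp c"] bs unfolding s_def by blast
  define x where "x = k w"
  have "hinv c t < x" using w homeo_shift[OF G_carrier[OF k(1)]] by (simp add: x_def)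
  then have "t < c x" using homeo_shift[OF G_carrier[OF cG]] by simp
  then have 1: "d (c x) = c x" by (rule above)
  have "d x \<noteq> x" using w k by (simp add: d_def x_def supp_def)
  then have "c (d x) \<noteq> c x" using cG by simp
  then have "c \<circ> d \<noteq> d \<circ> c" using 1 by (metis comp_apply)
  then show ?thesis using that cD dD by blast
qed

end

section \<open>Minimal actions\<close>

text \<open>\<open>x \<otimes> P\<close> is the commutator of \<open>x\<close> and
  \<open>\<nu>\<close>, hence in \<open>N\<close>, and so is its commutator with \<open>y\<close>.
  As \<open>P\<close> commutes with \<open>y\<close>, the latter is the commutator of
  \<open>x\<close> and \<open>y\<close>.\<close>

lemma (in group) normal_contains_commutator:
  assumes N: "N \<lhd> G" and \<nu>: "\<nu> \<in> N" and x: "x \<in> carrier G" "y \<in> carrier G"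
    and comm: "(\<nu> \<otimes> inv x \<otimes> inv \<nu>) \<otimes> y = y \<otimes> (\<nu> \<otimes> inv x \<otimes> inv \<nu>)"
  shows "x \<otimes> y \<otimes> inv x \<otimes> inv y \<in> N"
proof -
  interpret N: normal N G by fact
  define P where "P = \<nu> \<otimes> inv x \<otimes> inv \<nu>"
  have c: "\<nu> \<in> carrier G" using \<nu> by simp
  have P: "P \<in> carrier G" using c x by (simp add: P_def)
  have "(x \<otimes> \<nu> \<otimes> inv x) \<otimes> inv \<nu> \<in> N"
    using \<nu> x N.inv_op_closed2 by simp
  then have C: "x \<otimes> P \<in> N" using c x by (simp add: P_def m_assoc)
  then have "y \<otimes> inv (x \<otimes> P) \<otimes> inv y \<in> N" using x N.inv_op_closed2 by simp
  with C have "(x \<otimes> P) \<otimes> (y \<otimes> inv (x \<otimes> P) \<otimes> inv y) \<in> N" by simp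
  also have "(x \<otimes> P) \<otimes> (y \<otimes> inv (x \<otimes> P) \<otimes> inv y) = x \<otimes> (P \<otimes> y) \<otimes> inv P \<otimes> inv x \<otimes> inv y"
    using P x by (simp add: m_assoc inv_mult_group)
  also have "P \<otimes> y = y \<otimes> P" using comm by (simp add: P_def)
  also have "x \<otimes> (y \<otimes> P) \<otimes> inv P \<otimes> inv x \<otimes> inv y = x \<otimes> y \<otimes> inv x \<otimes> inv y"
    using P x by (simp add: m_assoc)
  finally show ?thesis .
qed

lemma (in group) normal_commutator_conj:
  assumes N: "N \<lhd> G" and c: "g \<in> carrier G" "x \<in> carrier G" "y \<in> carrier G"
    and xg: "xg = g \<otimes> x \<otimes> inv g" and yg: "yg = g \<otimes> y \<otimes> inv g"
    and mem: "xg \<otimes> yg \<otimes> inv xg \<otimes> inv yg \<in> N"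
  shows "x \<otimes> y \<otimes> inv x \<otimes> inv y \<in> N"
proof -
  interpret N: normal N G by fact
  have "inv g \<otimes> (xg \<otimes> yg \<otimes> inv xg \<otimes> inv yg) \<otimes> g \<in> N"
    using mem c N.inv_op_closed1 by simp
  moreover have ig: "inv g \<otimes> (g \<otimes> z) = z" "g \<otimes> (inv g \<otimes> z) = z" if "z \<in> carrier G" for z
    using that c by (simp_all add: m_assoc[symmetric])
  have "inv g \<otimes> (xg \<otimes> yg \<otimes> inv xg \<otimes> inv yg) \<otimes> g = x \<otimes> y \<otimes> inv x \<otimes> inv y"
    using c by (simp add: xg yg m_assoc inv_mult_group ig)
  ultimately show ?thesis by simp
qed

text \<open>A nontrivial normal subgroup \<open>N\<close> contains \<open>[\<alpha>, \<gamma>]\<close> for all compactly supported \<open>\<alpha>, \<gamma>\<close>: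
  conjugate their supports into an interval displaced by some \<open>\<nu> \<in> N\<close>; there
  \<open>[\<alpha>, \<gamma>] = [[\<alpha>, \<nu>], \<gamma>]\<close>, because \<open>\<nu> \<alpha>\<inverse> \<nu>\<inverse>\<close> commutes with \<open>\<gamma>\<close>.\<close>

lemma (in homeo_group) commutator_in_normal_subgroup:
  assumes I: "is_interval I" "Supp G \<subseteq> I" "\<And>g x. g \<in> G \<Longrightarrow> g x \<in> I \<longleftrightarrow> x \<in> I"
    and trans: "\<And>p q u v. p \<in> I \<Longrightarrow> q \<in> I \<Longrightarrow> p < q \<Longrightarrow> u \<in> I \<Longrightarrow> v \<in> I \<Longrightarrow> u < v
      \<Longrightarrow> \<exists>g\<in>G. u < g p \<and> g q < v"
    and N: "N \<lhd> as_group G" "N \<noteq> {id}"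
    and \<alpha>: "\<alpha> \<in> G" "\<And>x. x < p \<or> q < x \<Longrightarrow> \<alpha> x = x"
    and \<gamma>: "\<gamma> \<in> G" "\<And>x. x < p \<or> q < x \<Longrightarrow> \<gamma> x = x"
    and pq: "p \<in> I" "q \<in> I" "p < q"
  shows "\<alpha> \<circ> \<gamma> \<circ> hinv \<alpha> \<circ> hinv \<gamma> \<in> N"
proof -
  interpret K: group "as_group G" by (rule subgroup_as_group)
  interpret N: normal N "as_group G" by fact
  have NG: "N \<subseteq> G" using N.subset by simp
  have "id \<in> N" using N.one_closed by simp
  then obtain \<nu>0 where \<nu>0: "\<nu>0 \<in> N" "\<nu>0 \<noteq> id" using N(2) by blast
  then obtain x where x: "\<nu>0 x \<noteq> x" by (metis eq_id_iff)
  have \<nu>0G: "\<nu>0 \<in> G" using \<nu>0 NG by blast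
  have "hinv \<nu>0 \<in> N" using N.m_inv_closed[OF \<nu>0(1)] \<nu>0G by simp
  moreover have "x < \<nu>0 x \<or> x < hinv \<nu>0 x"
    using x homeo_shift(2)[OF G_carrier[OF \<nu>0G], of x x] by auto
  ultimately obtain \<nu> where \<nu>: "\<nu> \<in> N" "x < \<nu> x" using \<nu>0 by blast
  have \<nu>G: "\<nu> \<in> G" using \<nu> NG by blast
  note \<nu>c = G_carrier[OF \<nu>G]
  have "x \<in> Supp G" using \<nu> \<nu>G by (force simp: Supp_def supp_def)
  then have xI: "x \<in> I" using I(2) by blast
  \<comment> \<open>With \<open>v\<close> between \<open>x\<close> and \<open>\<nu> x\<close> and
    \<open>u\<close> its preimage, \<open>\<nu>\<close> carries the interval from \<open>u\<close>
    to \<open>v\<close> to the right of \<open>v\<close>.\<close>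
  obtain v where v: "x < v" "v < \<nu> x" using dense \<nu>(2) by blast
  then have vI: "v \<in> I" using I(1,3) xI \<nu>G unfolding is_interval_1 by (meson less_imp_le)
  define u where "u = hinv \<nu> v"
  have uI: "u \<in> I" using I(3) vI \<nu>G by (simp add: u_def G_inv)
  have uv: "u < v" using v homeo_shift[OF \<nu>c] unfolding u_def by (meson less_trans)
  have \<nu>u: "\<nu> u = v" using \<nu>c by (simp add: u_def)
  obtain g where g: "g \<in> G" "u < g p" "g q < v" using trans[OF pq uI vI uv] by blast
  note gc = G_carrier[OF g(1)]
  define A B where "A = g \<circ> \<alpha> \<circ> hinv g" and "B = g \<circ> \<gamma> \<circ> hinv g"
  have AG: "A \<in> G" and BG: "B \<in> G" using g \<alpha> \<gamma> by (auto simp: A_def B_def)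
  have fixed: "g (\<kappa> (hinv g y)) = y" if "y \<le> u \<or> v \<le> y" "\<And>x. x < p \<or> q < x \<Longrightarrow> \<kappa> x = x" for \<kappa> y
  proof -
    have "y < g p \<or> g q < y" using that g by auto
    then have "hinv g y < p \<or> q < hinv g y" using homeo_shift[OF gc] by simp
    then show ?thesis using that gc by simp
  qed
  have A: "A y = y" and B: "B y = y" if "y \<le> u \<or> v \<le> y" for y
    using fixed[OF that \<alpha>(2)] fixed[OF that \<gamma>(2)] by (simp_all add: A_def B_def)
  define P where "P = \<nu> \<circ> hinv A \<circ> hinv \<nu>"
  have PG: "P \<in> G" using \<nu>G AG by (auto simp: P_def)
  have P: "P y = y" if "y \<le> v" for y
  proof -
    have "hinv \<nu> y \<le> u" using that \<nu>c homeo_le_iff[OF G_carrier[OF G_inv[OF \<nu>G]]] by (simp add: u_def)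
    then have "A (hinv \<nu> y) = hinv \<nu> y" by (intro A) simp
    then have "hinv A (hinv \<nu> y) = hinv \<nu> y"
      using homeo_inv_simps(2)[OF G_carrier[OF AG]] by metis
    then show ?thesis using \<nu>c by (simp add: P_def)
  qed
  have "P y = y \<or> B y = y" for y using P[of y] B[of y] by linarith
  then have "P \<circ> B = B \<circ> P" using PG BG by (intro disjoint_supports_commute) auto
  then have "A \<otimes>\<^bsub>as_group G\<^esub> B \<otimes>\<^bsub>as_group G\<^esub> inv\<^bsub>as_group G\<^esub> A \<otimes>\<^bsub>as_group G\<^esub> inv\<^bsub>as_group G\<^esub> B \<in> N"
    using AG BG \<nu>G by (intro K.normal_contains_commutator[OF N(1) \<nu>(1)]) (simp_all add: P_def)
  then have "\<alpha> \<otimes>\<^bsub>as_group G\<^esub> \<gamma> \<otimes>\<^bsub>as_group G\<^esub> inv\<^bsub>as_group G\<^esub> \<alpha> \<otimes>\<^bsub>as_group G\<^esub> inv\<^bsub>as_group G\<^esub> \<gamma> \<in> N"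
    by (rule K.normal_commutator_conj[OF N(1), of g, rotated -1]) (use g \<alpha> \<gamma> in \<open>simp_all add: A_def B_def\<close>)
  then show ?thesis using \<alpha> \<gamma> by simp
qed

section \<open>Displacing compact intervals by \<open>G\<close> and by its commutator
  subgroup\<close>

context chain
begin

lemma minimal_transitive:
  assumes "acts_minimally G" and pq: "p \<in> I" "q \<in> I" "p < q" and uv: "u \<in> I" "v \<in> I" "u < v"
  shows "\<exists>g\<in>G. u < g p \<and> g q < v"
proof -
  obtain m where m: "u < m" "m < v" using dense uv by blast
  then have "m \<in> I" using I_between[OF uv(1,2), of m] by simp
  then have "m \<in> orbit_closure G (b 1)" using assms(1) acts_minimally_iff by blast
  then obtain h where h: "h \<in> G" "u < h (b 1)" "h (b 1) < v"
    using m unfolding orbit_closure_iff[OF beta_I] by blast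
  then have h': "hinv h u < b 1" "b 1 < hinv h v" using homeo_shift[OF G_carrier] by blast+
  obtain y where y: "y \<in> J 1" "hinv h u < y" using J_near_b[OF one_less_n(1) h'(1)] by blast
  obtain g where g: "g \<in> G" "g q \<in> J 1" using reach[OF pq(2) one_less_n(2)] by blast
  have "g p \<in> I" "g p \<le> g q" using pq g by simp_all
  then have gp: "g p \<in> J 1" using J1_below g by blast
  \<comment> \<open>Only the left end has to be pushed close to \<open>b 1\<close>; the right end
    stays in \<open>J 1\<close> and thus below \<open>b 1\<close>.\<close>
  obtain k where "y < (f 1 ^^ k) (g p)"
    using homeo_bump[OF f_homeo J(3) f_up gp y(1)] one_less_n(2) by blast
  moreover have "(f 1 ^^ k) (g q) < b 1"
    using ab(5)[OF one_less_n(1)] pow_J[OF one_less_n(2) g(2)] by blast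
  ultimately have "hinv h u < (f 1 ^^ k) (g p)" "(f 1 ^^ k) (g q) < hinv h v" using y h' by linarith+
  then have "u < (h \<circ> (f 1 ^^ k) \<circ> g) p" "(h \<circ> (f 1 ^^ k) \<circ> g) q < v"
    using homeo_shift[OF G_carrier[OF h(1)]] by simp_all
  moreover have "h \<circ> (f 1 ^^ k) \<circ> g \<in> G"
    using h g G_pow f_G one_less_n by (intro G_comp) auto
  ultimately show ?thesis by blast
qed

text \<open>Modulo the commutator subgroup, every generator can be replaced by a conjugate whose
  support avoids a prescribed compact interval.\<close>

lemma modify_modulo_derived:
  assumes pq: "p \<in> I" "q \<in> I" and g: "g \<in> G"
  shows "\<exists>r\<in>G. (\<forall>x. p \<le> x \<and> x \<le> q \<longrightarrow> r x = x) \<and> hinv r \<circ> g \<in> D"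
proof -
  \<comment> \<open>\<open>J n\<close> is bounded on the left and can be moved beyond
    \<open>q\<close>; every other support is bounded on the right and can be moved below
    \<open>p\<close>.\<close>
  have conj_gen: "\<exists>h\<in>G. \<forall>x. p \<le> x \<and> x \<le> q \<longrightarrow> f i (hinv h x) = hinv h x" if i: "i \<in> {1..n}" for i
  proof (cases "i = n")
    case True
    have "a (n - 1) \<in> I" using J_I[of "n - 1"] ab(1)[OF one_less_n(4)] one_less_n(4) by simp
    then obtain h where h: "h \<in> G" "q < h (a (n - 1))" using reach_above pq by blast
    have "f i (hinv h x) = hinv h x" if "x \<le> q" for x
    proof -
      have "hinv h x < a (n - 1)" using that h homeo_shift[OF G_carrier[OF h(1)]] by simp
      then have "hinv h x \<notin> J i" using ab(4)[OF one_less_n(4), of "hinv h x"] True n by auto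
      then show ?thesis by (simp add: supp_def)
    qed
    then show ?thesis using h by blast
  next
    case False
    then have i': "i \<in> {1..<n}" using i by simp
    have "b i \<in> I" using J_I[of "i + 1"] ab(2)[OF i'] i' by simp
    then obtain h where h: "h \<in> G" "h (b i) < p" using reach_below pq by blast
    have "f i (hinv h x) = hinv h x" if "p \<le> x" for x
    proof -
      have "b i < hinv h x" using that h homeo_shift[OF G_carrier[OF h(1)]] by simp
      then have "hinv h x \<notin> J i" using ab(5)[OF i', of "hinv h x"] by auto
      then show ?thesis by (simp add: supp_def)
    qed
    then show ?thesis using h by blast
  qed
  show ?thesis using g
  proof (induction rule: G_induct)
    case id
    have X: "hinv id \<in> D" using HP.inv_one D.G_id by simp
    show ?case by (rule bexI[of _ id]) (use X G_id in \<open>simp_all add: id_def comp_def\<close>)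
  next
    case (gen i)
    obtain h where h: "h \<in> G" "\<And>x. p \<le> x \<Longrightarrow> x \<le> q \<Longrightarrow> f i (hinv h x) = hinv h x"
      using conj_gen[OF gen] by metis
    have fi: "f i \<in> G" by (rule f_G[OF gen])
    define r where "r = h \<circ> f i \<circ> hinv h"
    have rG: "r \<in> G" using h fi by (auto simp: r_def)
    have "hinv r = h \<circ> hinv (f i) \<circ> hinv h"
      using HP.inv_mult_group[of "h \<circ> f i" "hinv h"] HP.inv_mult_group[of h "f i"] h fi G_comp
      by (simp add: r_def comp_assoc)
    moreover have "h \<circ> hinv (f i) \<circ> hinv h \<circ> hinv (hinv (f i)) \<in> D"
      using h fi by (intro commutator_D) auto
    ultimately have "hinv r \<circ> f i \<in> D" using fi by simp
    moreover have "r x = x" if "p \<le> x" "x \<le> q" for x using h that by (simp add: r_def)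
    ultimately show ?case using rG by blast
  next
    case (inv i)
    obtain h where h: "h \<in> G" "\<And>x. p \<le> x \<Longrightarrow> x \<le> q \<Longrightarrow> f i (hinv h x) = hinv h x"
      using conj_gen[OF inv] by metis
    have fi: "f i \<in> G" by (rule f_G[OF inv])
    define r where "r = h \<circ> hinv (f i) \<circ> hinv h"
    have rG: "r \<in> G" using h fi by (auto simp: r_def)
    have "h \<circ> hinv (f i) \<in> carrier homeo_plus" using h fi by (intro G_carrier G_comp G_inv)
    then have "hinv r = h \<circ> f i \<circ> hinv h"
      using HP.inv_mult_group[of "h \<circ> hinv (f i)" "hinv h"] HP.inv_mult_group[of h "hinv (f i)"] h fi G_comp
      by (simp add: r_def comp_assoc)
    moreover have "h \<circ> f i \<circ> hinv h \<circ> hinv (f i) \<in> D"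
      using h fi by (intro commutator_D) auto
    ultimately have "hinv r \<circ> hinv (f i) \<in> D" by simp
    moreover have "r x = x" if "p \<le> x" "x \<le> q" for x
    proof -
      have "hinv (f i) (hinv h x) = hinv h x"
        using h(2)[OF that] homeo_inv_simps(2)[OF G_carrier[OF fi]] by metis
      then show ?thesis using h by (simp add: r_def)
    qed
    ultimately show ?case using rG by blast
  next
    case (comp g h)
    obtain r where r: "r \<in> G" "\<forall>x. p \<le> x \<and> x \<le> q \<longrightarrow> r x = x" "hinv r \<circ> g \<in> D" using comp by blast
    obtain s where s: "s \<in> G" "\<forall>x. p \<le> x \<and> x \<le> q \<longrightarrow> s x = x" "hinv s \<circ> h \<in> D" using comp by blast
    \<comment> \<open>Moving \<open>hinv s\<close> across \<open>hinv r \<circ> g\<close> costs a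
      conjugation, under which \<open>D\<close> is invariant.\<close>
    have "(hinv s \<circ> (hinv r \<circ> g) \<circ> hinv (hinv s)) \<circ> (hinv s \<circ> h) \<in> D"
      using r s D_conj by blast
    also have "(hinv s \<circ> (hinv r \<circ> g) \<circ> hinv (hinv s)) \<circ> (hinv s \<circ> h) = hinv (r \<circ> s) \<circ> (g \<circ> h)"
      using r s HP.inv_mult_group[of r s] by (simp add: fun_eq_iff)
    finally have "hinv (r \<circ> s) \<circ> (g \<circ> h) \<in> D" .
    moreover have "(r \<circ> s) x = x" if "p \<le> x" "x \<le> q" for x using r s that by simp
    moreover have "r \<circ> s \<in> G" using r s by blast
    ultimately show ?case by blast
  qed
qed

text \<open>Take \<open>g\<close> from \<open>minimal_transitive\<close> and an \<open>r\<close>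
  that agrees with \<open>g\<close> modulo \<open>D\<close> and fixes the image of the interval;
  \<open>hinv r \<circ> g\<close> lies in \<open>D\<close> and has the same values as
  \<open>g\<close> at \<open>p\<close> and \<open>q\<close>.\<close>

lemma derived_transitive:
  assumes "acts_minimally G" and pq: "p \<in> I" "q \<in> I" "p < q" and uv: "u \<in> I" "v \<in> I" "u < v"
  shows "\<exists>g\<in>D. u < g p \<and> g q < v"
proof -
  obtain g where g: "g \<in> G" "u < g p" "g q < v" using minimal_transitive[OF assms] by blast
  have I: "g p \<in> I" "g q \<in> I" using g pq by simp_all
  obtain r where r: "r \<in> G" "\<And>x. g p \<le> x \<Longrightarrow> x \<le> g q \<Longrightarrow> r x = x" "hinv r \<circ> g \<in> D"
    using modify_modulo_derived[OF I g(1)] by blast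
  have "g p \<le> g q" using g pq by simp
  then have "r (g p) = g p" "r (g q) = g q" using r(2) by simp_all
  then have "(hinv r \<circ> g) p = g p" "(hinv r \<circ> g) q = g q"
    using homeo_inv_simps(2)[OF G_carrier[OF r(1)]] by (metis comp_apply)+
  then show ?thesis using g r(3) by (intro bexI[of _ "hinv r \<circ> g"]) simp_all
qed

lemma derived_commutator_in_normal:
  assumes "acts_minimally G" "N \<lhd> as_group G" "N \<noteq> {id}" and c: "c \<in> D" "d \<in> D"
  shows "c \<circ> d \<circ> hinv c \<circ> hinv d \<in> N"
proof -
  obtain p q where p: "p \<in> I" "q \<in> I" "p < q" "\<And>x. x < p \<or> q < x \<Longrightarrow> c x = x"
    using derived_compact_support[OF c(1)] by metis
  obtain p' q' where p': "p' \<in> I" "q' \<in> I" "p' < q'" "\<And>x. x < p' \<or> q' < x \<Longrightarrow> d x = x"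
    using derived_compact_support[OF c(2)] by metis
  show ?thesis
  proof (rule commutator_in_normal_subgroup[OF I_interval _ _ minimal_transitive[OF assms(1)] assms(2,3),
      of _ "min p p'" "max q q'"])
    show "c x = x" "d x = x" if "x < min p p' \<or> max q q' < x" for x
      using that p(4) p'(4) by auto
  qed (use p p' c D_G in \<open>auto simp: min_def max_def\<close>)
qed

text \<open>\<open>N\<close> is normal in \<open>D\<close> only, so intervals must be moved by
  elements of \<open>D\<close>; \<open>derived_transitive\<close> provides them.\<close>

lemma derived_commutator_in_derived_normal:
  assumes "acts_minimally G" "N \<lhd> as_group D" "N \<noteq> {id}" and c: "c \<in> D" "d \<in> D"
  shows "c \<circ> d \<circ> hinv c \<circ> hinv d \<in> N"
proof -
  obtain p q where p: "p \<in> I" "q \<in> I" "p < q" "\<And>x. x < p \<or> q < x \<Longrightarrow> c x = x"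
    using derived_compact_support[OF c(1)] by metis
  obtain p' q' where p': "p' \<in> I" "q' \<in> I" "p' < q'" "\<And>x. x < p' \<or> q' < x \<Longrightarrow> d x = x"
    using derived_compact_support[OF c(2)] by metis
  show ?thesis
  proof (rule D.commutator_in_normal_subgroup[OF I_interval _ _ derived_transitive[OF assms(1)] assms(2,3),
      of _ "min p p'" "max q q'"])
    show "Supp D \<subseteq> I" using D_G by (auto simp: Supp_def)
    show "g x \<in> I \<longleftrightarrow> x \<in> I" if "g \<in> D" for g x using that D_G by auto
    show "c x = x" "d x = x" if "x < min p p' \<or> max q q' < x" for x
      using that p(4) p'(4) by auto
  qed (use p p' c in \<open>auto simp: min_def max_def\<close>)
qed

lemma hom_commute:
  assumes L: "group L" and \<pi>: "\<pi> \<in> hom (as_group G) L"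
    and gen: "\<And>i j. i \<in> {1..n} \<Longrightarrow> j \<in> {1..n} \<Longrightarrow> \<pi> (f i) \<otimes>\<^bsub>L\<^esub> \<pi> (f j) = \<pi> (f j) \<otimes>\<^bsub>L\<^esub> \<pi> (f i)"
    and g: "g \<in> G" and h: "h \<in> G"
  shows "\<pi> g \<otimes>\<^bsub>L\<^esub> \<pi> h = \<pi> h \<otimes>\<^bsub>L\<^esub> \<pi> g"
proof -
  interpret L: group L by fact
  interpret K: group "as_group G" by (rule subgroup_as_group)
  interpret \<pi>: group_hom "as_group G" L \<pi> using \<pi> by unfold_locales
  have c: "\<pi> k \<in> carrier L" if "k \<in> G" for k using \<pi>.hom_closed that by simp
  have step: "y \<otimes>\<^bsub>L\<^esub> \<pi> k = \<pi> k \<otimes>\<^bsub>L\<^esub> y"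
    if y: "y \<in> carrier L" "\<And>i. i \<in> {1..n} \<Longrightarrow> y \<otimes>\<^bsub>L\<^esub> \<pi> (f i) = \<pi> (f i) \<otimes>\<^bsub>L\<^esub> y" and k: "k \<in> G" for y k
    using k
  proof (induction rule: G_induct)
    case id
    have "y \<otimes>\<^bsub>L\<^esub> \<pi> id = \<pi> id \<otimes>\<^bsub>L\<^esub> y" using \<pi>.hom_one y(1) by simp
    then show ?case unfolding id_def .
  next
    case (gen i)
    then show ?case by (rule y(2))
  next
    case (inv i)
    have "\<pi> (hinv (f i)) = inv\<^bsub>L\<^esub> \<pi> (f i)" using \<pi>.hom_inv[of "f i"] f_G[OF inv] by simp
    then show ?case using L.commute_inv[OF y(1) c y(2)] f_G inv by simp
  next
    case (comp g h)
    have "\<pi> (g \<circ> h) = \<pi> g \<otimes>\<^bsub>L\<^esub> \<pi> h" using \<pi>.hom_mult[of g h] comp by simp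
    then have "y \<otimes>\<^bsub>L\<^esub> \<pi> (g \<circ> h) = \<pi> (g \<circ> h) \<otimes>\<^bsub>L\<^esub> y"
      using L.commute_mult[OF y(1) c c] comp by simp
    then show ?case unfolding comp_def .
  qed
  have "\<pi> (f i) \<otimes>\<^bsub>L\<^esub> \<pi> h = \<pi> h \<otimes>\<^bsub>L\<^esub> \<pi> (f i)" if "i \<in> {1..n}" for i
    by (rule step[OF c[OF f_G[OF that]] gen[OF that] h])
  then show ?thesis by (intro step[OF c[OF h] _ g, symmetric]) simp
qed

text \<open>The index shift sends \<open>k = 1, 2\<close> to \<open>f i\<close> and
  \<open>f (i + 1)\<close>. Results on chains thus apply to each copy of \<open>F\<close>, in
  particular \<open>derived_derived_nontrivial\<close>.\<close>

lemma pair: assumes i: "i \<in> {1..<n}" shows "chain 2 (\<lambda>k. f (i + k - 1))"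
proof
  have J: "supp (f i) \<noteq> {} \<and> open (supp (f i)) \<and> is_interval (supp (f i))"
    "supp (f (i + 1)) \<noteq> {} \<and> open (supp (f (i + 1))) \<and> is_interval (supp (f (i + 1)))"
    using J i by simp_all
  have *: "{1..2} = {1, 2::nat}" "{1..<2} = {1::nat}" by auto
  show "chain_of_intervals 2 (\<lambda>k. supp (f (i + k - 1)))"
    using chain i J unfolding chain_of_intervals_def * by simp
  show "left_endpoint (supp (f (i + k - 1))) < left_endpoint (supp (f (i + (k + 1) - 1)))"
    if "k \<in> {1..<2}" for k
  proof -
    have "k = 1" using that by auto
    then show ?thesis using left[OF i] by simp
  qed
  show "f (i + k - 1) \<in> carrier homeo_plus" if "k \<in> {1..2}" for k
    by (rule f_homeo) (use i that in auto)
  show "t \<le> f (i + k - 1) t" if "k \<in> {1..2}" for k t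
    by (rule f_up) (use i that in auto)
qed simp

lemma pair_G: "i \<in> {1..<n} \<Longrightarrow> chain.G 2 (\<lambda>k. f (i + k - 1)) = generate homeo_plus {f i, f (i + 1)}"
proof -
  assume i: "i \<in> {1..<n}"
  have *: "{1..2} = {1, 2::nat}" by auto
  show ?thesis unfolding chain.G_def[OF pair[OF i]] * by simp
qed

lemma far_generators_commute:
  assumes "i \<in> {1..n}" "j \<in> {1..n}" "\<bar>int i - int j\<bar> > 1"
  shows "f i \<circ> f j = f j \<circ> f i"
  using J_disjoint[OF assms] f_homeo assms
  by (intro disjoint_supports_commute) (auto simp: supp_def)

text \<open>For a pair of generators this supplies a kernel element in a copy of \<open>F\<close>;
  for the whole chain, a nontrivial normal subgroup inside \<open>D\<close>.\<close>

lemma derived_derived_nontrivial: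
  obtains e where "e \<in> derived homeo_plus D" "e \<noteq> id"
proof -
  obtain c d where cd: "c \<in> D" "d \<in> D" "c \<circ> d \<noteq> d \<circ> c" by (rule derived_nonabelian)
  define e where "e = c \<circ> d \<circ> hinv c \<circ> hinv d"
  have "e \<in> derived homeo_plus D"
    unfolding derived_def e_def using cd by (intro generate.incl) fastforce
  moreover have "e \<noteq> id"
  proof
    assume "e = id"
    then have "e \<circ> d \<circ> c = d \<circ> c" by simp
    moreover have "e \<circ> d \<circ> c = c \<circ> d" using cd by (simp add: e_def fun_eq_iff)
    ultimately show False using cd by simp
  qed
  ultimately show ?thesis by (rule that)
qed

end

section \<open>Quotients and the commutator subgroup in the minimal case\<close>

locale thompson_chain = chain +
  assumes iso: "i \<in> {1..<n} \<Longrightarrow> as_group (generate homeo_plus {f i, f (i + 1)}) \<cong> thompson_F"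
begin

text \<open>\<open>e\<close> is built from commutators of elements of
  \<open>P.D \<subseteq> D\<close>, which lie in \<open>N\<close> by minimality of \<open>G\<close>,
  not of the pair. So the projection is not injective on this copy of \<open>F\<close>, and its
  image there is abelian.\<close>

lemma quotient_generators_commute:
  assumes min: "acts_minimally G" and N: "N \<lhd> as_group G" "N \<noteq> {id}" and i: "i \<in> {1..<n}"
  defines "\<pi> \<equiv> (\<lambda>g. N #>\<^bsub>as_group G\<^esub> g)" and "L \<equiv> as_group G Mod N"
  shows "\<pi> (f i) \<otimes>\<^bsub>L\<^esub> \<pi> (f (i + 1)) = \<pi> (f (i + 1)) \<otimes>\<^bsub>L\<^esub> \<pi> (f i)"
proof -
  interpret K: group "as_group G" by (rule subgroup_as_group)
  interpret N: normal N "as_group G" by fact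
  interpret P: chain 2 "\<lambda>k. f (i + k - 1)" by (rule pair[OF i])
  define H where "H = generate homeo_plus {f i, f (i + 1)}"
  have PG: "P.G = H" using pair_G[OF i] by (simp add: H_def)
  have fi: "f i \<in> H" "f (i + 1) \<in> H" by (auto simp: H_def intro: generate.incl)
  have HG: "H \<subseteq> G" unfolding H_def G_def using i by (intro HP.mono_generate) auto
  obtain e where e: "e \<in> derived homeo_plus P.D" "e \<noteq> id" by (rule P.derived_derived_nontrivial)
  have PD: "P.D \<subseteq> D" unfolding D_def P.D_def PG by (rule HP.mono_derived[OF HG])
  have "derived homeo_plus P.D \<subseteq> N"
    unfolding derived_def
  proof (rule HP.generate_subgroup_incl)
    show "subgroup N homeo_plus"
      using HP.incl_subgroup[OF subgroup_G] N.subgroup_axioms by blast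
    show "derived_set homeo_plus P.D \<subseteq> N"
    proof
      fix x assume "x \<in> derived_set homeo_plus P.D"
      then obtain c d where "c \<in> P.D" "d \<in> P.D" "x = c \<circ> d \<circ> hinv c \<circ> hinv d" by auto
      then show "x \<in> N" using derived_commutator_in_normal[OF min N] PD by blast
    qed
  qed
  then have eN: "e \<in> N" using e by blast
  have "derived homeo_plus P.D \<subseteq> P.D" by (rule HP.derived_incl[OF _ P.D_subgroup]) simp
  then have eH: "e \<in> H" using e P.D_G PG by blast
  have "\<pi> \<in> hom (as_group G) L" unfolding \<pi>_def L_def by (rule N.r_coset_hom_Mod)
  then have hom: "\<pi> \<in> hom (as_group H) L" using HG by (auto simp: hom_def Pi_def subset_iff)
  have L: "group L" unfolding L_def by (rule N.factorgroup_is_group)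
  have "\<pi> e = \<one>\<^bsub>L\<^esub>"
    unfolding \<pi>_def L_def using K.coset_join2[OF _ N.subgroup_axioms eN] eN N.subset
    by (auto simp: FactGroup_def)
  moreover have "group (as_group H)" using P.subgroup_as_group PG by simp
  ultimately show ?thesis
    using thompson_F_proper_quotient_abelian[OF _ _ L hom, of e "f i" "f (i + 1)"] iso[OF i] eH e fi
    by (simp add: H_def)
qed

lemma quotient_commute:
  assumes min: "acts_minimally G" and N: "N \<lhd> as_group G" "N \<noteq> {id}" and gh: "g \<in> G" "h \<in> G"
  defines "\<pi> \<equiv> (\<lambda>g. N #>\<^bsub>as_group G\<^esub> g)" and "L \<equiv> as_group G Mod N"
  shows "\<pi> g \<otimes>\<^bsub>L\<^esub> \<pi> h = \<pi> h \<otimes>\<^bsub>L\<^esub> \<pi> g"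
proof (rule hom_commute[OF _ _ _ gh])
  interpret N: normal N "as_group G" by fact
  show "group L" unfolding L_def by (rule N.factorgroup_is_group)
  show hom: "\<pi> \<in> hom (as_group G) L" unfolding \<pi>_def L_def by (rule N.r_coset_hom_Mod)
  fix i j assume ij: "i \<in> {1..n}" "j \<in> {1..n}"
  consider "i = j" | "j = i + 1" | "i = j + 1" | "\<bar>int i - int j\<bar> > 1" by linarith
  then show "\<pi> (f i) \<otimes>\<^bsub>L\<^esub> \<pi> (f j) = \<pi> (f j) \<otimes>\<^bsub>L\<^esub> \<pi> (f i)"
  proof cases
    case 2
    then show ?thesis using quotient_generators_commute[OF min N, of i] ij by (simp add: \<pi>_def L_def)
  next
    case 3
    then show ?thesis using quotient_generators_commute[OF min N, of j] ij by (simp add: \<pi>_def L_def)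
  next
    case 4
    have "\<pi> (f i \<circ> f j) = \<pi> (f i) \<otimes>\<^bsub>L\<^esub> \<pi> (f j)" "\<pi> (f j \<circ> f i) = \<pi> (f j) \<otimes>\<^bsub>L\<^esub> \<pi> (f i)"
      using hom_mult[OF hom] f_G ij by fastforce+
    then show ?thesis using far_generators_commute[OF ij 4] by simp
  qed simp
qed

lemma minimal_quotient_abelian:
  assumes "acts_minimally G" "N \<lhd> as_group G" "N \<noteq> {id}"
  shows "comm_group (as_group G Mod N)"
proof -
  interpret N: normal N "as_group G" by fact
  show ?thesis
  proof (rule group.group_comm_groupI[OF N.factorgroup_is_group])
    fix x y assume "x \<in> carrier (as_group G Mod N)" "y \<in> carrier (as_group G Mod N)"
    then obtain g h where "g \<in> G" "h \<in> G" "x = N #>\<^bsub>as_group G\<^esub> g" "y = N #>\<^bsub>as_group G\<^esub> h"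
      by (auto simp: carrier_FactGroup)
    then show "x \<otimes>\<^bsub>as_group G Mod N\<^esub> y = y \<otimes>\<^bsub>as_group G Mod N\<^esub> x"
      using quotient_commute[OF assms] by simp
  qed
qed

lemma derived_subset_normal:
  assumes "acts_minimally G" "N \<lhd> as_group G" "N \<noteq> {id}"
  shows "D \<subseteq> N"
proof -
  interpret K: group "as_group G" by (rule subgroup_as_group)
  interpret N: normal N "as_group G" by fact
  have "derived_set homeo_plus G \<subseteq> N"
  proof
    fix x assume "x \<in> derived_set homeo_plus G"
    then obtain g h where gh: "g \<in> G" "h \<in> G" "x = g \<circ> h \<circ> hinv g \<circ> hinv h" by auto
    have "N #>\<^bsub>as_group G\<^esub> (g \<circ> h) = N #>\<^bsub>as_group G\<^esub> (h \<circ> g)"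
      using quotient_commute[OF assms gh(1,2)] hom_mult[OF N.r_coset_hom_Mod] gh by simp
    moreover have "g \<circ> h \<in> N #>\<^bsub>as_group G\<^esub> (g \<circ> h)"
      using K.rcos_self[OF _ N.subgroup_axioms, of "g \<circ> h"] gh by auto
    ultimately obtain m where m: "m \<in> N" "g \<circ> h = m \<circ> (h \<circ> g)" by (auto simp: r_coset_def)
    have "x = (g \<circ> h) \<circ> (hinv g \<circ> hinv h)" by (simp add: gh comp_assoc)
    also have "\<dots> = m" unfolding m(2) using gh by (simp add: fun_eq_iff)
    finally show "x \<in> N" using m by simp
  qed
  moreover have "subgroup N homeo_plus"
    using HP.incl_subgroup[OF subgroup_G] N.subgroup_axioms by blast
  ultimately show ?thesis unfolding D_def derived_def by (intro HP.generate_subgroup_incl)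
qed

text \<open>A nontrivial normal subgroup of \<open>D\<close> contains the commutator subgroup of
  \<open>D\<close>. The latter is normal in \<open>G\<close> and nontrivial, so it contains
  \<open>D\<close> by \<open>derived_subset_normal\<close>.\<close>

lemma minimal_derived_simple:
  assumes min: "acts_minimally G"
  shows "is_simple (as_group D)"
  unfolding is_simple_def
proof (intro conjI allI impI)
  show "group (as_group D)" by (rule D.subgroup_as_group)
  obtain e where e: "e \<in> derived homeo_plus D" "e \<noteq> id" by (rule derived_derived_nontrivial)
  have "derived homeo_plus D \<subseteq> D" by (rule HP.derived_incl[OF _ D_subgroup]) simp
  then show "carrier (as_group D) \<noteq> {\<one>\<^bsub>as_group D\<^esub>}" using e by auto
  fix M assume M: "M \<lhd> as_group D"
  interpret M: normal M "as_group D" by fact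
  show "M = carrier (as_group D) \<or> M = {\<one>\<^bsub>as_group D\<^esub>}"
  proof (cases "M = {id}")
    case False
    have "derived homeo_plus D \<subseteq> M"
      unfolding derived_def
    proof (rule HP.generate_subgroup_incl)
      show "subgroup M homeo_plus"
        using HP.incl_subgroup[OF D_subgroup] M.subgroup_axioms by blast
      show "derived_set homeo_plus D \<subseteq> M"
      proof
        fix x assume "x \<in> derived_set homeo_plus D"
        then obtain c d where "c \<in> D" "d \<in> D" "x = c \<circ> d \<circ> hinv c \<circ> hinv d" by auto
        then show "x \<in> M" using derived_commutator_in_derived_normal[OF min M False] by blast
      qed
    qed
    moreover have "derived homeo_plus D \<lhd> as_group G"
      using group.derived_is_normal[OF subgroup_as_group D_normal] HP.derived_consistent[OF D_G subgroup_G]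
      by simp
    then have "D \<subseteq> derived homeo_plus D" using e by (intro derived_subset_normal[OF min]) auto
    ultimately show ?thesis using M.subset by auto
  qed simp
qed

end

section \<open>Minimalization\<close>

context chain
begin

text \<open>\<open>f (i + 1)\<close> fixes \<open>a i\<close> and, if the two commuted, would also
  fix \<open>f i (a i)\<close>, which lies in the overlap of the supports.\<close>

lemma consecutive_noncommuting:
  assumes i: "i \<in> {1..<n}"
  shows "f i \<circ> f (i + 1) \<noteq> f (i + 1) \<circ> f i"
proof
  assume eq: "f i \<circ> f (i + 1) = f (i + 1) \<circ> f i"
  have c: "f i \<in> carrier homeo_plus" using f_homeo i by simp
  have "a i \<notin> J (i + 1)" using ab(4)[OF i, of "a i"] by blast
  then have "f (i + 1) (f i (a i)) = f i (a i)"
    using fun_cong[OF eq, of "a i"] by (simp add: supp_def)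
  then have 1: "f i (a i) \<notin> J (i + 1)" by (simp add: supp_def)
  have 2: "f i (a i) \<in> J i" using ab(1)[OF i] supp_inv[OF c] by blast
  have "a i < f i (a i)" using ab(1)[OF i] f_up[of i "a i"] i by (simp add: supp_def less_le)
  then have "f i (a i) \<in> {a i<..<b i}" using ab(5)[OF i 2] by simp
  then show False using 1 ab(6)[OF i] by blast
qed

text \<open>The point \<open>l\<close> separates \<open>g x\<close> from \<open>u\<close>, so that
  the collapsing map keeps \<open>u\<close> strictly below \<open>g x\<close>. This gives density of
  orbits after the collapse.\<close>

lemma orbit_near_beta_closure:
  assumes x: "x \<in> I" and p: "p \<in> orbit_closure G (b 1)" "u < p" "p < v"
  shows "\<exists>l\<in>orbit_closure G (b 1). \<exists>g\<in>G. u < l \<and> l < g x \<and> g x < v"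
proof -
  have *: ?thesis
    if lm: "l \<in> orbit_closure G (b 1)" "m \<in> orbit_closure G (b 1)" "u < l" "l < m" "m < v" for l m
  proof -
    have "m \<in> orbit_closure G x"
      using orbit_closure_trans[OF x beta_minimal[OF x]] lm by blast
    then obtain g where "g \<in> G" "l < g x" "g x < v"
      using lm unfolding orbit_closure_iff[OF x] by blast
    then show ?thesis using lm by blast
  qed
  obtain q where "q \<in> orbit_closure G (b 1)" "q \<noteq> p" "u < q" "q < v"
    using beta_orbit_closure_no_isolated[OF p] by blast
  then show ?thesis using *[of p q] *[of q p] p by (metis linorder_neqE)
qed

end

lemma (in group_hom) iso_image_generate:
  assumes K: "K \<subseteq> carrier G" and inj: "\<And>k. k \<in> generate G K \<Longrightarrow> h k = \<one>\<^bsub>H\<^esub> \<Longrightarrow> k = \<one>\<^bsub>G\<^esub>"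
  shows "G\<lparr>carrier := generate G K\<rparr> \<cong> H\<lparr>carrier := generate H (h ` K)\<rparr>"
proof -
  have sub: "generate G K \<subseteq> carrier G" using G.generate_in_carrier[OF K] by blast
  have "inj_on h (generate G K)"
  proof (rule inj_onI)
    fix x y assume xy: "x \<in> generate G K" "y \<in> generate G K" "h x = h y"
    then have c: "x \<in> carrier G" "y \<in> carrier G" using sub by auto
    have "x \<otimes>\<^bsub>G\<^esub> inv\<^bsub>G\<^esub> y \<in> generate G K"
      using xy G.generate_m_inv_closed[OF K] by (blast intro: generate.eng)
    moreover have "h (x \<otimes>\<^bsub>G\<^esub> inv\<^bsub>G\<^esub> y) = \<one>\<^bsub>H\<^esub>" using xy c by simp
    ultimately have "x \<otimes>\<^bsub>G\<^esub> inv\<^bsub>G\<^esub> y = \<one>\<^bsub>G\<^esub>" by (rule inj)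
    then show "x = y" using c by (metis G.inv_closed G.inv_equality G.inv_inv)
  qed
  moreover have "h ` generate G K = generate H (h ` K)" by (rule generate_img[OF K, symmetric])
  moreover have "h \<in> hom (G\<lparr>carrier := generate G K\<rparr>) (H\<lparr>carrier := generate H (h ` K)\<rparr>)"
    using sub calculation(2) by (auto simp: hom_def subset_iff)
  ultimately have "h \<in> iso (G\<lparr>carrier := generate G K\<rparr>) (H\<lparr>carrier := generate H (h ` K)\<rparr>)"
    by (simp add: iso_def bij_betw_def)
  then show ?thesis by (rule is_isoI)
qed

section \<open>The induced action on the collapsed line\<close>

locale collapsed_chain = thompson_chain +
  fixes h :: "real \<Rightarrow> real"
  assumes h_surj: "h ` I = UNIV"
    and h_less_iff: "\<And>x y. x \<in> I \<Longrightarrow> y \<in> I \<Longrightarrow>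
      h x < h y \<longleftrightarrow> (\<exists>p\<in>orbit_closure G (b 1). x < p \<and> p < y)"
    and h_cont: "continuous_on I h"
begin

abbreviation \<Lambda> where "\<Lambda> \<equiv> orbit_closure G (b 1)"

definition lift :: "real \<Rightarrow> real" where
  "lift t = (SOME x. x \<in> I \<and> h x = t)"

lemma lift: "lift t \<in> I" "h (lift t) = t"
proof -
  have "\<exists>x. x \<in> I \<and> h x = t" using h_surj by (metis UNIV_I imageE)
  then have "lift t \<in> I \<and> h (lift t) = t" unfolding lift_def by (rule someI_ex)
  then show "lift t \<in> I" "h (lift t) = t" by simp_all
qed

lemma h_mono: "x \<in> I \<Longrightarrow> y \<in> I \<Longrightarrow> x \<le> y \<Longrightarrow> h x \<le> h y"
  using h_less_iff[of y x] by (meson less_trans not_le)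

definition \<Phi> :: "(real \<Rightarrow> real) \<Rightarrow> real \<Rightarrow> real" where
  "\<Phi> g = (\<lambda>t. h (g (lift t)))"

lemma h_equivariant_less:
  assumes g: "g \<in> G" and xy: "x \<in> I" "y \<in> I"
  shows "h (g x) < h (g y) \<longleftrightarrow> h x < h y"
proof -
  have *: "h (g x) < h (g y)" if A: "h x < h y" "g \<in> G" "x \<in> I" "y \<in> I" for g x y
  proof -
    obtain p where "p \<in> \<Lambda>" "x < p" "p < y" using A h_less_iff by blast
    then have "g p \<in> \<Lambda>" "g x < g p" "g p < g y"
      using A orbit_closure_invariant[OF beta_I] by simp_all
    then have "\<exists>p\<in>\<Lambda>. g x < p \<and> p < g y" by blast
    then show ?thesis using A h_less_iff[of "g x" "g y"] by simp
  qed
  show ?thesis using *[of x y g] *[of "g x" "g y" "hinv g"] g xy by auto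
qed

text \<open>The choice made by \<open>lift\<close> does not matter: by
  \<open>h_equivariant_less\<close>, \<open>g\<close> sends points with equal \<open>h\<close> to
  points with equal \<open>h\<close>.\<close>

lemma \<Phi>_h: "g \<in> G \<Longrightarrow> x \<in> I \<Longrightarrow> \<Phi> g (h x) = h (g x)"
  using h_equivariant_less[of g x "lift (h x)"] h_equivariant_less[of g "lift (h x)" x] lift[of "h x"]
  by (simp add: \<Phi>_def)

lemma \<Phi>_comp: "g \<in> G \<Longrightarrow> k \<in> G \<Longrightarrow> \<Phi> (g \<circ> k) = \<Phi> g \<circ> \<Phi> k"
proof
  fix t assume gk: "g \<in> G" "k \<in> G"
  have "\<Phi> (g \<circ> k) t = h (g (k (lift t)))" by (simp add: \<Phi>_def)
  also have "\<dots> = \<Phi> g (h (k (lift t)))" using \<Phi>_h[OF gk(1), of "k (lift t)"] gk lift by simp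
  finally show "\<Phi> (g \<circ> k) t = (\<Phi> g \<circ> \<Phi> k) t" by (simp add: \<Phi>_def)
qed

lemma \<Phi>_id: "\<Phi> id = id"
  by (simp add: \<Phi>_def lift fun_eq_iff)

lemma \<Phi>_homeo: assumes g: "g \<in> G" shows "\<Phi> g \<in> carrier homeo_plus"
  unfolding homeo_carrier_iff
proof
  show "strict_mono (\<Phi> g)"
    by (rule strict_monoI) (use h_equivariant_less[OF g lift(1) lift(1)] lift(2) in \<open>simp add: \<Phi>_def\<close>)
  have "g \<circ> hinv g = id" using g by (simp add: fun_eq_iff)
  then have "\<Phi> g \<circ> \<Phi> (hinv g) = id" using \<Phi>_comp[OF g G_inv[OF g]] \<Phi>_id by simp
  then show "surj (\<Phi> g)" by (metis comp_apply id_apply surjI)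
qed

lemma \<Phi>_hom: "\<Phi> \<in> hom (as_group G) homeo_plus"
  using \<Phi>_homeo \<Phi>_comp by (auto simp: hom_def)

text \<open>Otherwise \<open>h\<close> would be constant on all iterates of \<open>x\<close> under
  \<open>f i\<close>. But these overtake a point of \<open>\<Lambda>\<close> that lies in
  \<open>J i\<close> above \<open>x\<close>, and this point separates them from
  \<open>x\<close>.\<close>

lemma h_moved:
  assumes i: "i \<in> {1..n}" and x: "x \<in> J i"
  shows "h x < h (f i x)"
proof (rule ccontr)
  assume n: "\<not> h x < h (f i x)"
  have fG: "f i \<in> G" by (rule f_G[OF i])
  have xI: "x \<in> I" by (rule J_I[OF i x])
  have eq: "h (f i x) = h x" using n h_mono[of x "f i x"] f_up[OF i] xI fG by (simp add: not_less antisym)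
  have pow: "(f i ^^ k) x \<in> I" for k using G_pow[OF fG] xI by simp
  have const: "h ((f i ^^ k) x) = h x" for k
  proof (induction k)
    case (Suc k)
    have "h ((f i ^^ Suc k) x) = \<Phi> (f i) (h ((f i ^^ k) x))" using \<Phi>_h[OF fG pow] by simp
    also have "\<dots> = h x" using Suc \<Phi>_h[OF fG xI] eq by simp
    finally show ?case .
  qed simp
  obtain g where g: "g \<in> G" "g (b 1) \<in> J i" using reach[OF beta_I i] by blast
  obtain m where m: "x < (f i ^^ m) (g (b 1))"
    using homeo_bump[OF f_homeo J(3) f_up g(2) x] i by blast
  define p where "p = (f i ^^ m) (g (b 1))"
  have "p \<in> \<Lambda>" unfolding p_def
    by (rule orbit_closure_invariant[OF beta_I G_pow[OF fG]
          orbit_closure_invariant[OF beta_I g(1) beta_self]])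
  moreover have "p \<in> J i" unfolding p_def by (rule pow_J[OF i g(2)])
  then obtain k where "p < (f i ^^ k) x"
    using homeo_bump[OF f_homeo J(3) f_up x] i by blast
  ultimately have "h x < h ((f i ^^ k) x)" using h_less_iff[OF xI pow] m p_def by blast
  then show False using const by simp
qed

text \<open>Within \<open>I\<close>, \<open>J i\<close> is thus a union of fibres of
  \<open>h\<close>; this is why disjointness and proper overlap of supports survive the
  collapse.\<close>

lemma h_supp_iff:
  assumes i: "i \<in> {1..n}" and x: "x \<in> I"
  shows "h x \<in> supp (\<Phi> (f i)) \<longleftrightarrow> x \<in> J i"
proof -
  have "\<Phi> (f i) (h x) = h (f i x)" by (rule \<Phi>_h[OF f_G[OF i] x])
  moreover have "h (f i x) = h x" if "x \<notin> J i" using that by (simp add: supp_def)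
  ultimately show ?thesis using h_moved[OF i, of x] by (auto simp: supp_def[of "\<Phi> (f i)"])
qed

lemma supp_\<Phi>: "i \<in> {1..n} \<Longrightarrow> supp (\<Phi> (f i)) = h ` J i"
  using h_supp_iff lift J_I by (auto simp: image_iff) metis

lemma \<Phi>_chain: "chain n (\<lambda>i. \<Phi> (f i))"
proof
  show "2 \<le> n" by (rule n)
  show hom: "\<Phi> (f i) \<in> carrier homeo_plus" if "i \<in> {1..n}" for i
    by (rule \<Phi>_homeo[OF f_G[OF that]])
  show "t \<le> \<Phi> (f i) t" if i: "i \<in> {1..n}" for i t
  proof -
    have "h (lift t) \<le> h (f i (lift t))"
      using h_mono[of "lift t" "f i (lift t)"] lift f_up[OF i] f_G[OF i] by simp
    then show ?thesis by (simp add: \<Phi>_def lift)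
  qed
  have int: "is_interval (supp (\<Phi> (f i)))" if "i \<in> {1..n}" for i
    unfolding supp_\<Phi>[OF that] is_interval_connected_1
    by (rule connected_continuous_image)
      (use continuous_on_subset[OF h_cont] J_I that J(3) is_interval_connected in \<open>blast+\<close>)
  show "chain_of_intervals n (\<lambda>i. supp (\<Phi> (f i)))"
    unfolding chain_of_intervals_def
  proof (intro conjI ballI impI)
    fix i assume i: "i \<in> {1..n}"
    show "supp (\<Phi> (f i)) \<noteq> {}" using supp_\<Phi>[OF i] J(1)[OF i] by simp
    show "open (supp (\<Phi> (f i)))" by (rule open_supp[OF hom[OF i]])
    show "is_interval (supp (\<Phi> (f i)))" by (rule int[OF i])
    fix k assume k: "k \<in> {1..n}" "1 < \<bar>int i - int k\<bar>"
    show "supp (\<Phi> (f i)) \<inter> supp (\<Phi> (f k)) = {}"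
    proof (rule Int_emptyI)
      fix t assume "t \<in> supp (\<Phi> (f i))" "t \<in> supp (\<Phi> (f k))"
      then have "lift t \<in> J i \<inter> J k"
        using h_supp_iff[OF i lift(1), of t] h_supp_iff[OF k(1) lift(1), of t] lift(2) by simp
      then show False using J_disjoint[OF i k] by blast
    qed
  next
    fix i assume i: "i \<in> {1..<n}"
    then have i': "i \<in> {1..n}" "i + 1 \<in> {1..n}" by auto
    show "is_interval (supp (\<Phi> (f i)) \<inter> supp (\<Phi> (f (i + 1))))"
      by (rule is_interval_Int[OF int[OF i'(1)] int[OF i'(2)]])
    obtain m where "a i < m" "m < b i" using dense ab(3)[OF i] by blast
    then have "m \<in> J i \<inter> J (i + 1)" using ab(6)[OF i] by simp
    then show "supp (\<Phi> (f i)) \<inter> supp (\<Phi> (f (i + 1))) \<noteq> {}"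
      using supp_\<Phi>[OF i'(1)] supp_\<Phi>[OF i'(2)] by blast
    have "a i \<notin> J (i + 1)" using ab(4)[OF i, of "a i"] by blast
    then have "h (a i) \<in> supp (\<Phi> (f i)) - supp (\<Phi> (f (i + 1)))"
      using h_supp_iff[OF i'(1)] h_supp_iff[OF i'(2)] ab(1)[OF i] J_I[OF i'(1)] by blast
    then show "supp (\<Phi> (f i)) \<inter> supp (\<Phi> (f (i + 1))) \<subset> supp (\<Phi> (f i))" by blast
    have "b i \<notin> J i" using ab(5)[OF i, of "b i"] by blast
    then have "h (b i) \<in> supp (\<Phi> (f (i + 1))) - supp (\<Phi> (f i))"
      using h_supp_iff[OF i'(1)] h_supp_iff[OF i'(2)] ab(2)[OF i] J_I[OF i'(2)] by blast
    then show "supp (\<Phi> (f i)) \<inter> supp (\<Phi> (f (i + 1))) \<subset> supp (\<Phi> (f (i + 1)))" by blast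
  qed
  show "left_endpoint (supp (\<Phi> (f i))) < left_endpoint (supp (\<Phi> (f (i + 1))))"
    if i: "i \<in> {1..<n}" for i
  proof -
    have i': "i \<in> {1..n}" "i + 1 \<in> {1..n}" using i by auto
    have aI: "a i \<in> I" using J_I[OF i'(1)] ab(1)[OF i] by blast
    \<comment> \<open>\<open>h (a i)\<close> bounds the next support from below and lies inside the
      open support of \<open>\<Phi> (f i)\<close>, which therefore reaches further to the
      left.\<close>
    have "h (a i) \<in> supp (\<Phi> (f i))" using h_supp_iff[OF i'(1) aI] ab(1)[OF i] by blast
    then obtain e where e: "0 < e" "ball (h (a i)) e \<subseteq> supp (\<Phi> (f i))"
      using open_supp[OF hom[OF i'(1)]] open_contains_ball by blast
    have "h (a i) - e / 2 \<in> ball (h (a i)) e" using e by (simp add: dist_real_def)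
    then have "left_endpoint (supp (\<Phi> (f i))) \<le> ereal (h (a i) - e / 2)"
      using e unfolding left_endpoint_def by (intro INF_lower) blast
    also have "\<dots> < ereal (h (a i))" using e by simp
    also have "\<dots> \<le> left_endpoint (supp (\<Phi> (f (i + 1))))"
      unfolding left_endpoint_def supp_\<Phi>[OF i'(2)]
    proof (rule INF_greatest)
      fix t assume "t \<in> h ` J (i + 1)"
      then obtain y where y: "y \<in> J (i + 1)" "t = h y" by blast
      then have "h (a i) \<le> h y" using ab(4)[OF i y(1)] J_I[OF i'(2) y(1)] aI by (intro h_mono) auto
      then show "ereal (h (a i)) \<le> ereal t" using y by simp
    qed
    finally show ?thesis .
  qed
qed

lemma \<Phi>_generate: "K \<subseteq> G \<Longrightarrow> \<Phi> ` generate homeo_plus K = generate homeo_plus (\<Phi> ` K)"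
  and \<Phi>_pair_iso: "i \<in> {1..<n} \<Longrightarrow>
    as_group (generate homeo_plus {\<Phi> (f i), \<Phi> (f (i + 1))}) \<cong> thompson_F"
proof -
  interpret \<Phi>: group_hom "as_group G" homeo_plus \<Phi>
    using \<Phi>_hom subgroup_as_group by (simp add: group_hom_def group_hom_axioms_def HP.is_group)
  have gen: "generate (as_group G) K = generate homeo_plus K" if "K \<subseteq> G" for K
    by (rule HP.generate_consistent[OF that subgroup_G])
  show "\<Phi> ` generate homeo_plus K = generate homeo_plus (\<Phi> ` K)" if "K \<subseteq> G"
    using \<Phi>.generate_img[of K] gen[OF that] that by simp
  show "as_group (generate homeo_plus {\<Phi> (f i), \<Phi> (f (i + 1))}) \<cong> thompson_F" if i: "i \<in> {1..<n}"
  proof -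
    define K where "K = {f i, f (i + 1)}"
    define H where "H = generate homeo_plus K"
    have KG: "K \<subseteq> G" using f_G i by (simp add: K_def)
    have HG: "H \<subseteq> G" unfolding H_def by (rule HP.generate_subgroup_incl[OF KG subgroup_G])
    have H: "subgroup H homeo_plus"
      unfolding H_def by (rule HP.generate_is_subgroup) (use KG in auto)
    then interpret H: homeo_group H by (rule homeo_group.intro)
    have iso': "as_group H \<cong> thompson_F" using iso[OF i] by (simp add: H_def K_def)
    have fH: "f i \<in> H" "f (i + 1) \<in> H" by (auto simp: H_def K_def intro: generate.incl)
    have hom: "\<Phi> \<in> hom (as_group H) homeo_plus" using \<Phi>_hom HG by (auto simp: hom_def Pi_def subset_iff)
    \<comment> \<open>A nontrivial kernel element in this copy of \<open>F\<close> would make the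
      images of \<open>f i\<close> and \<open>f (i + 1)\<close> commute.\<close>
    have inj: "k = id" if k: "k \<in> H" "\<Phi> k = id" for k
    proof (rule ccontr)
      assume "k \<noteq> id"
      then have "\<Phi> (f i) \<circ> \<Phi> (f (i + 1)) = \<Phi> (f (i + 1)) \<circ> \<Phi> (f i)"
        using thompson_F_proper_quotient_abelian[OF H.subgroup_as_group iso' HP.is_group hom, of k "f i" "f (i + 1)"]
          k fH by simp
      then show False using chain.consecutive_noncommuting[OF \<Phi>_chain i] by simp
    qed
    have "as_group H \<cong> as_group (generate homeo_plus (\<Phi> ` K))"
      using \<Phi>.iso_image_generate[of K] KG gen[OF KG] inj by (simp add: H_def)
    then have "as_group (generate homeo_plus (\<Phi> ` K)) \<cong> as_group H"
      using group.iso_sym[OF H.subgroup_as_group] by blast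
    from iso_trans[OF this iso'] show ?thesis by (simp add: K_def)
  qed
qed

lemma \<Phi>_chain_group: "chain_group n (\<Phi> ` G)"
proof -
  interpret c: chain n "\<lambda>i. \<Phi> (f i)" by (rule \<Phi>_chain)
  have "f ` {1..n} \<subseteq> G" using f_G by blast
  from \<Phi>_generate[OF this] have "\<Phi> ` G = generate homeo_plus (\<Phi> ` f ` {1..n})"
    by (simp only: G_def)
  also have "\<Phi> ` f ` {1..n} = (\<lambda>i. \<Phi> (f i)) ` {1..n}" by (rule image_image)
  finally show ?thesis
    unfolding chain_group_def
    using c.n c.f_homeo c.chain c.left c.f_up \<Phi>_pair_iso by (intro conjI exI[of _ "\<lambda>i. \<Phi> (f i)"]) blast+
qed

lemma \<Phi>_minimal: "acts_minimally (\<Phi> ` G)"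
proof -
  interpret c: chain n "\<lambda>i. \<Phi> (f i)" by (rule \<Phi>_chain)
  have "f ` {1..n} \<subseteq> G" using f_G by blast
  from \<Phi>_generate[OF this] have G': "\<Phi> ` G = c.G"
    by (simp only: G_def c.G_def image_image)
  have "s \<in> orbit_closure c.G t" if st: "s \<in> Supp c.G" "t \<in> Supp c.G" for s t
    unfolding c.orbit_closure_iff[OF st(2)]
  proof (intro conjI st(1) allI impI)
    fix u v assume "u < s" "s < v"
    then have "h (lift u) < h (lift s)" "h (lift s) < h (lift v)" by (simp_all add: lift)
    \<comment> \<open>Points of \<open>\<Lambda>\<close> on both sides of \<open>lift s\<close>
      protect the strict inequalities from the collapse; the orbit of \<open>lift t\<close> is then
      made to meet the interval between some \<open>l\<close> in \<open>\<Lambda>\<close> and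
      \<open>p'\<close>.\<close>
    then obtain p p' where p: "p \<in> \<Lambda>" "lift u < p" "p < lift s"
      and p': "p' \<in> \<Lambda>" "lift s < p'" "p' < lift v"
      using h_less_iff lift by metis
    then have "p < p'" by simp
    then obtain l g where g: "l \<in> \<Lambda>" "g \<in> G" "lift u < l" "l < g (lift t)" "g (lift t) < p'"
      using orbit_near_beta_closure[OF lift(1) p(1,2)] by blast
    have gI: "g (lift t) \<in> I" using g lift by simp
    have "u < h (g (lift t))" using h_less_iff[OF lift(1) gI, of u] g lift by auto
    moreover have "h (g (lift t)) < v" using h_less_iff[OF gI lift(1), of v] g p' lift by auto
    ultimately have "u < \<Phi> g t \<and> \<Phi> g t < v" by (simp add: \<Phi>_def)
    moreover have "\<Phi> g \<in> c.G" using g(2) G' by blast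
    ultimately show "\<exists>g\<in>c.G. u < g t \<and> g t < v" by blast
  qed
  then show ?thesis
    using c.orbit_closure_I by (auto simp: acts_minimally_def G')
qed

text \<open>\<open>\<Lambda>\<close> lies in every orbit closure, so no point of
  \<open>\<Lambda>\<close> separates two points of a component \<open>C\<close> of the complement,
  nor a limit point of \<open>C\<close> from a point of \<open>C\<close>; hence \<open>h\<close> is
  constant there.\<close>

lemma minimalization_orbit_closure:
  assumes x: "x \<in> I"
  shows "minimalization G (orbit_closure G x) h \<Phi>"
proof -
  have "\<exists>c. \<forall>y\<in>top_of_set I closure_of C. h y = c"
    if "C \<in> components (I - orbit_closure G x)" for C
  proof -
    have C: "C \<noteq> {}" "connected C" "C \<subseteq> I - orbit_closure G x"
      using that in_components_nonempty in_components_connected in_components_subset by blast+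
    have "\<Lambda> \<subseteq> orbit_closure G x" using orbit_closure_trans[OF x beta_minimal[OF x]] by blast
    have gap: "\<not> (y < p \<and> p < z)" if A: "y \<in> C" "z \<in> C" "p \<in> \<Lambda>" for y z p
    proof
      assume "y < p \<and> p < z"
      then have "p \<in> {y..z}" by simp
      then have "p \<in> C" using connected_contains_Icc[OF C(2) A(1,2)] by blast
      then show False using C(3) A(3) \<open>\<Lambda> \<subseteq> orbit_closure G x\<close> by blast
    qed
    obtain z where z: "z \<in> C" using C by blast
    have zI: "z \<in> I" using z C by blast
    show "\<exists>c. \<forall>y\<in>top_of_set I closure_of C. h y = c"
    proof (intro exI[of _ "h z"] ballI)
      fix y assume "y \<in> top_of_set I closure_of C"
      then have y: "y \<in> I" "y \<in> closure C"
        using closure_mono[of "I \<inter> C" C] by (auto simp: closure_of_subtopology)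
      have near: "\<exists>w\<in>C. w \<in> T" if "open T" "y \<in> T" for T
        using open_Int_closure_eq_empty[OF that(1), of C] y that by blast
      show "h y = h z"
      proof (rule ccontr)
        assume "h y \<noteq> h z"
        then consider "h y < h z" | "h z < h y" by linarith
        then show False
        proof cases
          case 1
          then obtain p where p: "p \<in> \<Lambda>" "y < p" "p < z" using h_less_iff y zI by blast
          then obtain w where "w \<in> C" "w < p" using near[of "{..<p}"] by auto
          then show False using gap z p by blast
        next
          case 2
          then obtain p where p: "p \<in> \<Lambda>" "z < p" "p < y" using h_less_iff y zI by blast
          then obtain w where "w \<in> C" "p < w" using near[of "{p<..}"] by auto
          then show False using gap z p by blast
        qed
      qed
    qed
  qed
  moreover have "mono_on I h" by (intro mono_onI h_mono)
  ultimately show ?thesis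
    unfolding minimalization_def using h_cont h_surj \<Phi>_hom \<Phi>_h by simp
qed

end

context thompson_chain
begin

lemma minimalization_exists:
  assumes x: "x \<in> I"
  shows "\<exists>h \<Phi>. minimalization G (orbit_closure G x) h \<Phi> \<and>
    chain_group n (\<Phi> ` G) \<and> acts_minimally (\<Phi> ` G)"
proof -
  \<comment> \<open>The orbit of \<open>b 1\<close> supplies the points of its closure near both
    ends of \<open>I\<close> that \<open>collapse_map\<close> asks for.\<close>
  have *: "g (b 1) \<in> orbit_closure G (b 1) \<and> g (b 1) \<in> I" if "g \<in> G" for g
    using orbit_closure_invariant[OF beta_I that beta_self] beta_I that by simp
  have ne: "I \<noteq> {}" using x by blast
  have above: "\<exists>p\<in>orbit_closure G (b 1). y < p \<and> p \<in> I" if "y \<in> I" for y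
    using reach_above[OF beta_I that] * by blast
  have below: "\<exists>p\<in>orbit_closure G (b 1). p < y \<and> p \<in> I" if "y \<in> I" for y
    using reach_below[OF beta_I that] * by blast
  have "\<exists>h :: real \<Rightarrow> real. continuous_on I h \<and> h ` I = UNIV \<and> (\<forall>x\<in>I. \<forall>y\<in>I.
      h x < h y \<longleftrightarrow> (\<exists>p\<in>orbit_closure G (b 1). x < p \<and> p < y))"
  proof (rule collapse_map[OF I_interval I_open ne, of "orbit_closure G (b 1)"])
    fix h :: "real \<Rightarrow> real"
    assume h: "continuous_on I h" "h ` I = UNIV"
      "\<And>x y. x \<in> I \<Longrightarrow> y \<in> I \<Longrightarrow> h x < h y \<longleftrightarrow> (\<exists>p\<in>orbit_closure G (b 1). x < p \<and> p < y)"
    show ?thesis by (intro exI[of _ h] conjI ballI h)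
  qed (rule beta_orbit_closure_no_isolated above below; assumption)+
  then obtain h :: "real \<Rightarrow> real" where h: "continuous_on I h" "h ` I = UNIV"
    "\<forall>x\<in>I. \<forall>y\<in>I. h x < h y \<longleftrightarrow> (\<exists>p\<in>orbit_closure G (b 1). x < p \<and> p < y)"
    by blast
  interpret collapsed_chain n f h
    by unfold_locales (use h in blast)+
  show ?thesis using minimalization_orbit_closure[OF x] \<Phi>_chain_group \<Phi>_minimal by blast
qed

end

theorem theorem1p3:
  fixes n :: nat and G :: "(real \<Rightarrow> real) set"
  assumes "chain_group n G"
  shows
    "((acts_minimally G \<and> \<not> (\<exists>x\<in>Supp G. Cantor_orbit G x)) \<or>
      (\<not> acts_minimally G \<and> (\<exists>x\<in>Supp G. Cantor_orbit G x))) \<and>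
     (acts_minimally G \<longrightarrow>
        (\<forall>N. N \<lhd> as_group G \<and> N \<noteq> {\<one>\<^bsub>as_group G\<^esub>} \<longrightarrow> comm_group (as_group G Mod N)) \<and>
        is_simple (as_group (derived (as_group G) G))) \<and>
     (\<forall>x\<in>Supp G. Cantor_orbit G x \<longrightarrow>
        (\<exists>h \<Phi>. minimalization G (orbit_closure G x) h \<Phi> \<and>
               chain_group n (\<Phi> ` G) \<and> acts_minimally (\<Phi> ` G)))"
proof -
  obtain f where f: "thompson_chain n f" "G = generate homeo_plus (f ` {1..n})"
    using assms unfolding chain_group_def thompson_chain_def chain_def thompson_chain_axioms_def by blast
  interpret c: thompson_chain n f by (rule f(1))
  have G: "G = c.G" by (simp add: f(2) c.G_def)
  have 1: "(acts_minimally G \<and> \<not> (\<exists>x\<in>Supp G. Cantor_orbit G x)) \<or>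
      (\<not> acts_minimally G \<and> (\<exists>x\<in>Supp G. Cantor_orbit G x))"
    unfolding G using c.minimal_no_Cantor c.Cantor_orbit_beta c.beta_I by blast
  have 2: "comm_group (as_group G Mod N)"
    if "acts_minimally G" "N \<lhd> as_group G" "N \<noteq> {\<one>\<^bsub>as_group G\<^esub>}" for N
    using c.minimal_quotient_abelian[of N] that unfolding G by simp
  have 3: "is_simple (as_group (derived (as_group G) G))" if "acts_minimally G"
    using c.minimal_derived_simple that unfolding G c.D_eq by blast
  have 4: "\<exists>h \<Phi>. minimalization G (orbit_closure G x) h \<Phi> \<and>
      chain_group n (\<Phi> ` G) \<and> acts_minimally (\<Phi> ` G)" if "x \<in> Supp G" for x
    using c.minimalization_exists that unfolding G by blast
  show ?thesis using 1 2 3 4 by blast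
qed

end
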